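(* Let $\{p(x,y)\}_{x,y\in V}$ be the transition probabilities of an irreducible Markov chain on a countable state space $V$ with stationary distribution $\pi$, and assume that $p(x,x)\ge 1/2$ for all $x\in V$. Let $\epsilon>0$. Then the $\epsilon$-uniform mixing time satisfies $$\tau(\epsilon)\le 1+\int_{4\pi_*}^{4/\epsilon}\frac{4\,du}{u\,\Phi^2(u)}.$$ More precisely, for all $x,y\in V$ and every integer $n\ge 0$, if $$n\ge 1+\int_{4(\pi(x)\wedge\pi(y))}^{4/\epsilon}\frac{4\,du}{u\,\Phi^2(u)},$$ then $$\left|\frac{p^n(x,y)-\pi(y)}{\pi(y)}\right|\le\epsilon.$$
   Context: Here $\pi$ is a probability distribution on $V$ with $\sum_{x\in V}\pi(x)p(x,y)=\pi(y)$ for all $y$; reversibility is not assumed. $p^n(x,y)$ denotes the $n$-step transition probability and $\alpha\wedge\beta=\min\{\alpha,\beta\}$. Put $\pi_*=\inf_{x\in V}\pi(x)$. For $x,y\in V$ let $Q(x,y)=\pi(x)p(x,y)$, and for $S,A\subset V$ let $Q(S,A)=\sum_{s\in S,a\in A}Q(s,a)$. For nonempty $S\subset V$ the conductance of $S$ is $\Phi_S=Q(S,S^c)/\pi(S)$. The conductance profile is $\Phi(r)=\inf\{\Phi_S:\ \emptyset\ne S\subset V,\ \pi(S)\le r\}$ for $0<r\le 1/2$, and $\Phi(r)=\Phi(1/2)$ for $r>1/2$ (with $\inf\emptyset=+\infty$, $1/\infty=0$, $1/0=+\infty$). The $\epsilon$-uniform mixing time is $$\tau(\epsilon)=\min\left\{n\ge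 0:\ \left|\frac{p^n(x,y)-\pi(y)}{\pi(y)}\right|\le\epsilon\ \text{ for all }x,y\in V\right\}$$ (with $\min\emptyset=+\infty$). In the bound for $\tau(\epsilon)$, the integral is interpreted as $0$ if its lower limit is greater than or equal to its upper limit. *)

theory Defs
  imports "HOL-Probability.Probability"
begin

(* A Markov chain on 'v is given by its transition kernel P, with p(x,y) = pmf (P x) y. *)

primrec nstep :: "('v \<Rightarrow> 'v pmf) \<Rightarrow> nat \<Rightarrow> 'v \<Rightarrow> 'v pmf" where
  "nstep P 0 x = return_pmf x"
| "nstep P (Suc n) x = bind_pmf (P x) (nstep P n)"

definition irreducible_chain :: "('v \<Rightarrow> 'v pmf) \<Rightarrow> bool" where
  "irreducible_chain P \<longleftrightarrow> (\<forall>x y. \<exists>n. pmf (nstep P n x) y > 0)"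

definition stationary :: "('v \<Rightarrow> 'v pmf) \<Rightarrow> 'v pmf \<Rightarrow> bool" where
  "stationary P \<pi> \<longleftrightarrow> (\<forall>y. ((\<lambda>x. pmf \<pi> x * pmf (P x) y) has_sum pmf \<pi> y) UNIV)"

definition flow :: "('v \<Rightarrow> 'v pmf) \<Rightarrow> 'v pmf \<Rightarrow> 'v set \<Rightarrow> 'v set \<Rightarrow> real" where
  "flow P \<pi> S A = (\<Sum>\<^sub>\<infinity>(s, a)\<in>S \<times> A. pmf \<pi> s * pmf (P s) a)"

(* For an irreducible chain with stationary distribution \<pi>, every nonempty S has positive
   measure, so the denominator does not vanish where this is used. *)
definition conductance :: "('v \<Rightarrow> 'v pmf) \<Rightarrow> 'v pmf \<Rightarrow> 'v set \<Rightarrow> real" where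
  "conductance P \<pi> S = flow P \<pi> S (- S) / measure_pmf.prob \<pi> S"

(* The profile is constant for r \<ge> 1/2, hence the minimum.  The infimum is taken in ennreal,
   where the infimum of the empty set is \<infinity>. *)
definition conductance_profile :: "('v \<Rightarrow> 'v pmf) \<Rightarrow> 'v pmf \<Rightarrow> real \<Rightarrow> ennreal" where
  "conductance_profile P \<pi> r =
     (INF S\<in>{S. S \<noteq> {} \<and> measure_pmf.prob \<pi> S \<le> min r (1/2)}. ennreal (conductance P \<pi> S))"

(* In ennreal, 1/0 = \<infinity> and 1/\<infinity> = 0.  For a \<ge> b the domain is empty and the integral is 0. *)
definition profile_integral :: "('v \<Rightarrow> 'v pmf) \<Rightarrow> 'v pmf \<Rightarrow> real \<Rightarrow> real \<Rightarrow> ennreal" where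
  "profile_integral P \<pi> a b =
     (\<integral>\<^sup>+u\<in>{a<..<b}. 4 / (ennreal u * (conductance_profile P \<pi> u)\<^sup>2) \<partial>lborel)"

definition rel_deviation :: "('v \<Rightarrow> 'v pmf) \<Rightarrow> 'v pmf \<Rightarrow> nat \<Rightarrow> 'v \<Rightarrow> 'v \<Rightarrow> real" where
  "rel_deviation P \<pi> n x y = \<bar>(pmf (nstep P n x) y - pmf \<pi> y) / pmf \<pi> y\<bar>"

(* In enat, the infimum of a nonempty set is its minimum, and that of the empty set is \<infinity>. *)
definition unif_mixing_time :: "('v \<Rightarrow> 'v pmf) \<Rightarrow> 'v pmf \<Rightarrow> real \<Rightarrow> enat" where
  "unif_mixing_time P \<pi> \<epsilon> = (INF n\<in>{n. \<forall>x y. rel_deviation P \<pi> n x y \<le> \<epsilon>}. enat n)"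

end

theory Submission
  imports Defs
begin

text \<open>Write \<open>T f x\<close> for the mean of \<open>f\<close> after one step from \<open>x\<close>, and measure the distance of a density
\<open>f\<close> (\<open>f \<ge> 0\<close>, mean 1 under \<open>\<pi>\<close>) from the constant 1 by its variance, \<open>chi_square \<pi> f\<close>.
The functions \<open>p\<^sup>k(z, y) / \<pi>(y)\<close> of \<open>z\<close> are the iterates of \<open>T\<close> on the point density \<open>1\<^bsub>{y}\<^esub> / \<pi>(y)\<close>,
and the functions \<open>p\<^sup>m(x, z) / \<pi>(z)\<close> are the iterates of the adjoint of \<open>T\<close>, which is the operator of
the time-reversed chain, on \<open>1\<^bsub>{x}\<^esub> / \<pi>(x)\<close>. Hence \<open>p\<^sup>m\<^sup>+\<^sup>k(x, y) / \<pi>(y) - 1\<close> is the inner product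
of two centred densities, and is at most the mean of their two variances (\<open>rel_deviation_le\<close>).
The reversed chain is again lazy and has the same conductance profile \<open>\<Phi>\<close>, so it suffices to bound
the decay of one variance \<open>v\<^sub>m\<close> along the iteration.

Laziness gives \<open>E (T f)\<^sup>2 \<le> E f\<^sup>2 - D f\<close>, where \<open>D\<close> is the Dirichlet form (\<open>transition_op_energy\<close>).
Cheeger's argument, again with a gain from laziness, gives \<open>D f \<ge> \<phi>\<^sup>2 E f\<^sup>2\<close> if every level set of \<open>f\<close>
has conductance at least \<open>\<phi>\<close> (\<open>cheeger_dirichlet\<close>). For a density of variance \<open>v\<close>, cutting at height
\<open>v / 4\<close> loses at most half of the variance and leaves a function supported on a set of measure at
most \<open>4 / v\<close> (if \<open>4 / v > 1/2\<close>, cut at a median instead); hence \<open>v\<^sub>m\<^sub>+\<^sub>1 \<le> v\<^sub>m (1 - \<Phi>(4 / v\<^sub>m)\<^sup>2 / 2)\<close> (\<open>poincare_profile\<close>, \<open>chi_square_decay\<close>).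
As \<open>\<Phi>\<close> is nonincreasing, this says that the integral of \<open>4 / (u \<Phi>(u)\<^sup>2)\<close> from \<open>4 / v\<^sub>m\<close> to \<open>4 / v\<^sub>m\<^sub>+\<^sub>1\<close> is
at least 2. This is the spectral profile method of Goel, Montenegro and Tetali, and here it yields the
constants that Morris and Peres obtained from evolving sets.

So the integral up to \<open>4 / \<epsilon>\<close> exceeds \<open>2 m\<close> as long as \<open>v\<^sub>m > \<epsilon>\<close>, and splitting \<open>n\<close> into two halves
gives the second claim when \<open>n \<ge> 1 + I\<close>. The bound on the mixing time needs a little more, since it
involves no rounding: it asks for small deviation at the first integer \<open>n > I\<close>, which may be odd. The
missing half step comes from the point density, whose first step reduces the variance by the factor
\<open>1 - \<Phi>\<close> rather than \<open>1 - \<Phi>\<^sup>2 / 2\<close> and contributes at least 4 to the integral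
(\<open>chi_square_first_step\<close>, \<open>potential_lower_bound\<close>). Therefore \<open>n > I\<close> already
implies the deviation bound (\<open>rel_deviation_small\<close>), and both claims follow.\<close>


section \<open>Bounded functions under a probability mass function\<close>

text \<open>Point densities are bounded and averaging preserves bounds, so every function below is bounded, and
hence integrable for every probability mass function. The closure rules for bounded functions thus
replace all summability arguments.\<close>

definition bounded_fun :: "('a \<Rightarrow> real) \<Rightarrow> bool" where
  "bounded_fun f \<longleftrightarrow> (\<exists>C. \<forall>x. \<bar>f x\<bar> \<le> C)"

lemma bounded_funI: "(\<And>x. \<bar>f x\<bar> \<le> C) \<Longrightarrow> bounded_fun f"
  by (auto simp: bounded_fun_def)

lemma bounded_fun_const [simp, intro]: "bounded_fun (\<lambda>_. c)"
  by (rule bounded_funI[of _ "\<bar>c\<bar>"]) simp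

lemma bounded_fun_comp: "bounded_fun f \<Longrightarrow> bounded_fun (\<lambda>x. f (g x))"
  by (auto simp: bounded_fun_def)

lemma bounded_fun_indicator [simp, intro]: "bounded_fun (indicator S)"
  by (rule bounded_funI[of _ 1]) (simp add: indicator_def)

lemma bounded_fun_add [intro]:
  assumes "bounded_fun f" "bounded_fun g"
  shows "bounded_fun (\<lambda>x. f x + g x)"
proof -
  obtain C D where C: "\<And>x. \<bar>f x\<bar> \<le> C" and D: "\<And>x. \<bar>g x\<bar> \<le> D"
    using assms by (auto simp: bounded_fun_def)
  then have "\<bar>f x + g x\<bar> \<le> C + D" for x
    using C[of x] D[of x] by linarith
  then show ?thesis by (rule bounded_funI)
qed

lemma bounded_fun_mult [intro]:
  assumes "bounded_fun f" "bounded_fun g"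
  shows "bounded_fun (\<lambda>x. f x * g x)"
proof -
  obtain C D where C: "\<And>x. \<bar>f x\<bar> \<le> C" and D: "\<And>x. \<bar>g x\<bar> \<le> D"
    using assms by (auto simp: bounded_fun_def)
  then have "\<bar>f x * g x\<bar> \<le> C * D" for x
    using C[of x] D[of x] by (auto simp: abs_mult intro!: mult_mono')
  then show ?thesis by (rule bounded_funI)
qed

lemma bounded_fun_diff [intro]:
  assumes "bounded_fun f" "bounded_fun g"
  shows "bounded_fun (\<lambda>x. f x - g x)"
  using bounded_fun_add[OF assms(1) bounded_fun_mult[OF bounded_fun_const[of "-1"] assms(2)]]
  by simp

lemma bounded_fun_power2 [intro]: "bounded_fun f \<Longrightarrow> bounded_fun (\<lambda>x. (f x)\<^sup>2)"
  unfolding power2_eq_square by (rule bounded_fun_mult)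

lemma bounded_fun_divide [intro]: "bounded_fun f \<Longrightarrow> bounded_fun (\<lambda>x. f x / c)"
  using bounded_fun_mult[of f "\<lambda>_. 1 / c"] by auto

lemma bounded_fun_max [intro]:
  assumes "bounded_fun f" "bounded_fun g"
  shows "bounded_fun (\<lambda>x. max (f x) (g x))"
proof -
  obtain C D where C: "\<And>x. \<bar>f x\<bar> \<le> C" and D: "\<And>x. \<bar>g x\<bar> \<le> D"
    using assms by (auto simp: bounded_fun_def)
  then have "\<bar>max (f x) (g x)\<bar> \<le> max C D" for x
    using C[of x] D[of x] by linarith
  then show ?thesis by (rule bounded_funI)
qed

lemma integrable_bounded_fun [intro]: "bounded_fun f \<Longrightarrow> integrable (measure_pmf p) f"
  by (auto simp: bounded_fun_def intro!: measure_pmf.integrable_const_bound AE_pmfI)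

lemma expectation_bind_pmf:
  assumes "bounded_fun f"
  shows "measure_pmf.expectation (bind_pmf p q) f
    = measure_pmf.expectation p (\<lambda>x. measure_pmf.expectation (q x) f)"
proof -
  obtain C where C: "\<And>x. \<bar>f x\<bar> \<le> C" using assms by (auto simp: bounded_fun_def)
  show ?thesis
    unfolding measure_pmf_bind
    by (rule integral_bind[where K="count_space UNIV" and B=C and B'=1])
       (auto simp: C measure_pmf.emeasure_space_1 measure_pmf_in_subprob_algebra
          measure_pmf.finite_measure_axioms)
qed

lemma bounded_fun_expectation:
  assumes "bounded_fun f"
  shows "bounded_fun (\<lambda>x. measure_pmf.expectation (q x) f)"
proof -
  obtain C where C: "\<And>x. \<bar>f x\<bar> \<le> C" using assms by (auto simp: bounded_fun_def)
  have "\<bar>measure_pmf.expectation (q x) f\<bar> \<le> C" for x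
  proof -
    have "\<bar>measure_pmf.expectation (q x) f\<bar> \<le> measure_pmf.expectation (q x) (\<lambda>y. \<bar>f y\<bar>)"
      by (rule integral_abs_bound)
    also have "\<dots> \<le> measure_pmf.expectation (q x) (\<lambda>y. C)"
      by (rule integral_mono) (use C in \<open>auto intro!: integrable_bounded_fun bounded_funI[of _ C]\<close>)
    finally show ?thesis by simp
  qed
  then show ?thesis by (rule bounded_funI)
qed

text \<open>The function \<open>d\<close> lives on a set of probability at most 1/2, so Cauchy-Schwarz gains a factor 2. This
is the only use of laziness in the energy inequality below.\<close>

lemma square_expectation_le_of_atom:
  assumes d: "bounded_fun d" and x: "d x = 0" and half: "pmf p x \<ge> 1/2"
  shows "2 * (measure_pmf.expectation p d)\<^sup>2 \<le> measure_pmf.expectation p (\<lambda>y. (d y)\<^sup>2)"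
proof -
  \<comment> \<open>Expand \<open>E (d - 2 m 1\<^bsub>-{x}\<^esub>)\<^sup>2 \<ge> 0\<close>, where \<open>d\<close> already vanishes at \<open>x\<close>.\<close>
  define m where "m = measure_pmf.expectation p d"
  define q where "q = measure_pmf.prob p (- {x})"
  have q: "q \<le> 1/2"
    using half measure_pmf.prob_compl[of "{x}" p]
    by (simp add: q_def pmf.rep_eq Compl_eq_Diff_UNIV)
  have pt: "(d y)\<^sup>2 - 4 * m * d y + 4 * m\<^sup>2 * indicator (-{x}) y \<ge> 0" for y
  proof (cases "y = x")
    case False
    have "(d y - 2 * m)\<^sup>2 \<ge> 0" by simp
    then show ?thesis using False by (simp add: power2_eq_square algebra_simps)
  qed (simp add: x)
  have "0 \<le> measure_pmf.expectation p (\<lambda>y. (d y)\<^sup>2 - 4 * m * d y + 4 * m\<^sup>2 * indicator (-{x}) y)"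
    by (rule integral_nonneg_AE) (simp add: pt)
  also have "\<dots> = measure_pmf.expectation p (\<lambda>y. (d y)\<^sup>2) - 4 * m * m + 4 * m\<^sup>2 * q"
    using integrable_bounded_fun[OF d, of p] integrable_bounded_fun[OF bounded_fun_power2[OF d], of p]
      integrable_bounded_fun[OF bounded_fun_indicator, of p "- {x}"]
    by (simp add: m_def q_def)
  also have "\<dots> \<le> measure_pmf.expectation p (\<lambda>y. (d y)\<^sup>2) - 4 * m * m + 4 * m\<^sup>2 * (1/2)"
    using q by (intro add_left_mono mult_left_mono) auto
  finally show ?thesis by (simp add: m_def power2_eq_square)
qed

section \<open>The stationary chain as a distribution on edges\<close>

text \<open>The law of two consecutive states \<open>(X, Y)\<close> of the stationary chain. Stationarity says that both
marginals are \<open>\<pi>\<close>, flows become probabilities, and time reversal becomes swapping the coordinates.\<close>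

definition edge_pmf :: "('v \<Rightarrow> 'v pmf) \<Rightarrow> 'v pmf \<Rightarrow> ('v \<times> 'v) pmf" where
  "edge_pmf P \<pi> = bind_pmf \<pi> (\<lambda>x. map_pmf (Pair x) (P x))"

definition transition_op :: "('v \<Rightarrow> 'v pmf) \<Rightarrow> ('v \<Rightarrow> real) \<Rightarrow> 'v \<Rightarrow> real" where
  "transition_op P f x = measure_pmf.expectation (P x) f"

definition dirichlet :: "('v \<Rightarrow> 'v pmf) \<Rightarrow> 'v pmf \<Rightarrow> ('v \<Rightarrow> real) \<Rightarrow> real" where
  "dirichlet P \<pi> f = measure_pmf.expectation (edge_pmf P \<pi>) (\<lambda>(x, y). (f x - f y)\<^sup>2) / 2"

lemma pmf_edge_pmf: "pmf (edge_pmf P \<pi>) (x, y) = pmf \<pi> x * pmf (P x) y"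
proof -
  have "pmf (map_pmf (Pair z) (P z)) (x, y) = indicator {x} z * pmf (P x) y" for z
  proof (cases "z = x")
    case True
    then show ?thesis using pmf_map_inj'[of "Pair x" "P x" y] by (simp add: inj_on_def)
  next
    case False
    then show ?thesis by (simp add: pmf_map_outside image_iff)
  qed
  then have "pmf (edge_pmf P \<pi>) (x, y) = measure_pmf.expectation \<pi> (\<lambda>z. indicator {x} z * pmf (P x) y)"
    by (simp add: edge_pmf_def pmf_bind)
  then show ?thesis by (simp add: pmf.rep_eq)
qed

lemma flow_eq_prob_edge_pmf: "flow P \<pi> S A = measure_pmf.prob (edge_pmf P \<pi>) (S \<times> A)"
  unfolding flow_def measure_pmf_conv_infsetsum
  by (subst infsetsum_infsum) (auto simp: pmf_abs_summable pmf_edge_pmf split_def intro!: infsum_cong)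

lemma expectation_edge_pmf:
  assumes "bounded_fun F"
  shows "measure_pmf.expectation (edge_pmf P \<pi>) F
    = measure_pmf.expectation \<pi> (\<lambda>x. measure_pmf.expectation (P x) (\<lambda>y. F (x, y)))"
  using assms by (simp add: edge_pmf_def expectation_bind_pmf)

lemma map_fst_edge_pmf: "map_pmf fst (edge_pmf P \<pi>) = \<pi>"
  by (simp add: edge_pmf_def map_bind_pmf pmf.map_comp o_def map_pmf_const bind_return_pmf')

lemma map_snd_edge_pmf: "map_pmf snd (edge_pmf P \<pi>) = bind_pmf \<pi> P"
  by (simp add: edge_pmf_def map_bind_pmf pmf.map_comp o_def)

lemma transition_op_bounded [intro]: "bounded_fun f \<Longrightarrow> bounded_fun (transition_op P f)"
  unfolding transition_op_def by (rule bounded_fun_expectation)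

lemma has_sum_expectation:
  fixes f :: "'v \<Rightarrow> real"
  assumes "bounded_fun f"
  shows "((\<lambda>x. pmf p x * f x) has_sum measure_pmf.expectation p f) UNIV"
proof -
  have "integrable (measure_pmf p) f" using assms by auto
  then have "integrable (count_space UNIV) (\<lambda>x. pmf p x * f x)"
    by (simp add: measure_pmf_eq_density integrable_density)
  then have s: "Infinite_Set_Sum.abs_summable_on (\<lambda>x. pmf p x * f x) UNIV"
    by (simp add: Infinite_Set_Sum.abs_summable_on_def)
  have "measure_pmf.expectation p f = infsum (\<lambda>x. pmf p x * f x) UNIV"
    by (simp add: pmf_expectation_eq_infsetsum infsetsum_infsum[OF s])
  moreover have "(\<lambda>x. pmf p x * f x) summable_on UNIV"
    using s abs_summable_equivalent abs_summable_summable by blast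
  ultimately show ?thesis by simp
qed

lemma stationary_iff_bind_pmf: "stationary P \<pi> \<longleftrightarrow> bind_pmf \<pi> P = \<pi>"
proof -
  have hs: "((\<lambda>x. pmf \<pi> x * pmf (P x) y) has_sum pmf (bind_pmf \<pi> P) y) UNIV" for y
    unfolding pmf_bind
    by (rule has_sum_expectation) (auto intro!: bounded_funI[of _ 1] simp: pmf_le_1)
  show ?thesis
    unfolding stationary_def using hs by (metis has_sum_unique pmf_eqI)
qed

locale stationary_chain =
  fixes P :: "'v::countable \<Rightarrow> 'v pmf" and \<pi> :: "'v pmf"
  assumes bind_stationary: "bind_pmf \<pi> P = \<pi>"
begin

abbreviation "J \<equiv> edge_pmf P \<pi>"
abbreviation "T \<equiv> transition_op P"

lemma expectation_edge_fst: "measure_pmf.expectation J (\<lambda>e. f (fst e)) = measure_pmf.expectation \<pi> f"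
  for f :: "'v \<Rightarrow> real"
  using integral_map_pmf[of fst J f] by (simp add: map_fst_edge_pmf)

lemma expectation_edge_snd: "measure_pmf.expectation J (\<lambda>e. f (snd e)) = measure_pmf.expectation \<pi> f"
  for f :: "'v \<Rightarrow> real"
  using integral_map_pmf[of snd J f] by (simp add: map_snd_edge_pmf bind_stationary)

lemma expectation_transition_op:
  assumes "bounded_fun f"
  shows "measure_pmf.expectation \<pi> (T f) = measure_pmf.expectation \<pi> f"
  unfolding transition_op_def using expectation_bind_pmf[OF assms, of \<pi> P] bind_stationary by simp

text \<open>In stationarity a set is left as often as it is entered. This replaces reversibility: it makes the
conductances of a set the same for the chain and its reversal, and compares a set with its complement.\<close>

lemma prob_edge_compl_swap:
  "measure_pmf.prob J (S \<times> - S) = measure_pmf.prob J ((- S) \<times> S)"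
proof -
  have "measure_pmf.prob J (S \<times> UNIV) = measure_pmf.prob \<pi> S"
    by (subst (2) map_fst_edge_pmf[of P \<pi>, symmetric]) (auto simp: measure_map_pmf intro!: arg_cong[of _ _ "measure_pmf.prob J"])
  moreover have "measure_pmf.prob J (UNIV \<times> S) = measure_pmf.prob (map_pmf snd J) S"
    by (auto simp: measure_map_pmf intro!: arg_cong[of _ _ "measure_pmf.prob J"])
  moreover have "measure_pmf.prob J (S \<times> UNIV) = measure_pmf.prob J (S \<times> S) + measure_pmf.prob J (S \<times> - S)"
    by (subst measure_pmf.finite_measure_Union[symmetric]) (auto intro!: arg_cong[of _ _ "measure_pmf.prob J"])
  moreover have "measure_pmf.prob J (UNIV \<times> S) = measure_pmf.prob J (S \<times> S) + measure_pmf.prob J ((- S) \<times> S)"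
    by (subst measure_pmf.finite_measure_Union[symmetric]) (auto intro!: arg_cong[of _ _ "measure_pmf.prob J"])
  ultimately show ?thesis by (simp add: map_snd_edge_pmf bind_stationary)
qed

lemma conductance_eq: "conductance P \<pi> S = measure_pmf.prob J (S \<times> - S) / measure_pmf.prob \<pi> S"
  by (simp add: conductance_def flow_eq_prob_edge_pmf)

lemma dirichlet_mono:
  assumes f: "bounded_fun f" and g: "bounded_fun g"
    and le: "\<And>x y. \<bar>f x - f y\<bar> \<le> \<bar>g x - g y\<bar>"
  shows "dirichlet P \<pi> f \<le> dirichlet P \<pi> g"
proof -
  have b: "bounded_fun (\<lambda>e. (h (fst e) - h (snd e))\<^sup>2)" if "bounded_fun h" for h :: "'v \<Rightarrow> real"
    by (intro bounded_fun_power2 bounded_fun_diff bounded_fun_comp[OF that])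
  have "measure_pmf.expectation J (\<lambda>e. (f (fst e) - f (snd e))\<^sup>2)
      \<le> measure_pmf.expectation J (\<lambda>e. (g (fst e) - g (snd e))\<^sup>2)"
    by (intro integral_mono integrable_bounded_fun b f g) (simp add: abs_le_square_iff[symmetric] le)
  then show ?thesis by (simp add: dirichlet_def split_def)
qed

lemma dirichlet_nonneg: "dirichlet P \<pi> f \<ge> 0"
  unfolding dirichlet_def split_def by (auto intro!: integral_nonneg_AE)

section \<open>The Cheeger inequality for level sets\<close>

text \<open>Layer cake: the mean of \<open>(F X - F Y)\<^sup>+\<close> is the integral over \<open>t\<close> of the flow out of \<open>{F > t}\<close>,
and \<open>E F\<close> is the integral of \<open>\<pi> {F > t}\<close>. As \<open>F X - F Y\<close> has mean 0, the absolute value has twice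
the mean of the positive part.\<close>

lemma coarea_lower_bound:
  assumes F: "bounded_fun F" and nonneg: "\<And>x. 0 \<le> F x" and \<phi>: "0 \<le> \<phi>"
    and level: "\<And>t. 0 \<le> t \<Longrightarrow> \<phi> * measure_pmf.prob \<pi> {x. t < F x}
                  \<le> measure_pmf.prob J ({x. t < F x} \<times> - {x. t < F x})"
  shows "2 * \<phi> * measure_pmf.expectation \<pi> F \<le> measure_pmf.expectation J (\<lambda>(x, y). \<bar>F x - F y\<bar>)"
proof -
  interpret pi: pair_sigma_finite "measure_pmf \<pi>" lborel ..
  interpret J: pair_sigma_finite "measure_pmf J" lborel ..
  define pos where "pos = (\<lambda>e. max (F (fst e) - F (snd e)) 0)"
  define L where "L t = {x. t < F x}" for t
  have bpos: "bounded_fun pos"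
    unfolding pos_def by (intro bounded_fun_max bounded_fun_diff bounded_fun_comp[OF F] bounded_fun_const)
  \<comment> \<open>Tonelli needs joint measurability; sections suffice since the state space is countable.\<close>
  have meas: "(\<lambda>(x, t). f x t) \<in> borel_measurable (measure_pmf p \<Otimes>\<^sub>M lborel)"
    if "\<And>x. f x \<in> borel_measurable borel" for f :: "'c::countable \<Rightarrow> real \<Rightarrow> ennreal" and p
  proof -
    have "(\<lambda>(x, t). f x t) \<in> borel_measurable (count_space UNIV \<Otimes>\<^sub>M lborel)"
      using that by (intro measurable_pair_measure_countable1) auto
    then show ?thesis by (simp cong: measurable_cong_sets sets_pair_measure_cong)
  qed
  have "ennreal (\<phi> * measure_pmf.expectation \<pi> F) = ennreal \<phi> * (\<integral>\<^sup>+x. ennreal (F x) \<partial>\<pi>)"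
    using nonneg F \<phi> by (subst nn_integral_eq_integral) (auto simp: ennreal_mult)
  also have "(\<integral>\<^sup>+x. ennreal (F x) \<partial>\<pi>) = (\<integral>\<^sup>+x. \<integral>\<^sup>+t. indicator {0..<F x} t \<partial>lborel \<partial>\<pi>)"
    using nonneg by simp
  also have "\<dots> = (\<integral>\<^sup>+t. \<integral>\<^sup>+x. indicator {0..<F x} t \<partial>\<pi> \<partial>lborel)"
    by (intro pi.Fubini'[symmetric] meas) auto
  also have "ennreal \<phi> * \<dots> = (\<integral>\<^sup>+t. ennreal \<phi> * (\<integral>\<^sup>+x. indicator {0..<F x} t \<partial>\<pi>) \<partial>lborel)"
  proof (rule nn_integral_cmult[symmetric])
    have "(\<lambda>(x, t). indicator {0..<F x} t :: ennreal) \<in> borel_measurable (measure_pmf \<pi> \<Otimes>\<^sub>M lborel)"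
      by (rule meas) simp
    from measurable_pair_swap[OF this]
    show "(\<lambda>t. \<integral>\<^sup>+x. indicator {0..<F x} t \<partial>\<pi>) \<in> borel_measurable lborel"
      by (intro measure_pmf.borel_measurable_nn_integral) (simp add: split_def)
  qed
  also have "\<dots> \<le> (\<integral>\<^sup>+t. \<integral>\<^sup>+e. indicator {F (snd e)..<F (fst e)} t \<partial>J \<partial>lborel)"
  proof (rule nn_integral_mono)
    fix t :: real
    show "ennreal \<phi> * (\<integral>\<^sup>+x. indicator {0..<F x} t \<partial>\<pi>) \<le> (\<integral>\<^sup>+e. indicator {F (snd e)..<F (fst e)} t \<partial>J)"
    proof (cases "0 \<le> t")
      case True
      have "(\<integral>\<^sup>+x. indicator {0..<F x} t \<partial>\<pi>) = (\<integral>\<^sup>+x. indicator (L t) x \<partial>\<pi>)"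
        using True by (intro nn_integral_cong) (auto simp: L_def indicator_def)
      also have "\<dots> = ennreal (measure_pmf.prob \<pi> (L t))"
        by (simp add: measure_pmf.emeasure_eq_measure)
      finally have "ennreal \<phi> * (\<integral>\<^sup>+x. indicator {0..<F x} t \<partial>\<pi>)
          = ennreal (\<phi> * measure_pmf.prob \<pi> (L t))"
        using \<phi> by (simp add: ennreal_mult)
      also have "\<dots> \<le> ennreal (measure_pmf.prob J (L t \<times> - L t))"
        using level[OF True] unfolding L_def by (rule ennreal_leI)
      also have "\<dots> = (\<integral>\<^sup>+e. indicator (L t \<times> - L t) e \<partial>J)"
        by (simp add: measure_pmf.emeasure_eq_measure)
      also have "\<dots> = (\<integral>\<^sup>+e. indicator {F (snd e)..<F (fst e)} t \<partial>J)"
        by (intro nn_integral_cong) (auto simp: L_def indicator_def)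
      finally show ?thesis .
    qed simp
  qed
  also have "\<dots> = (\<integral>\<^sup>+e. \<integral>\<^sup>+t. indicator {F (snd e)..<F (fst e)} t \<partial>lborel \<partial>J)"
    by (intro J.Fubini' meas) auto
  also have "\<dots> = (\<integral>\<^sup>+e. ennreal (pos e) \<partial>J)"
  proof (rule nn_integral_cong)
    fix e show "(\<integral>\<^sup>+t. indicator {F (snd e)..<F (fst e)} t \<partial>lborel) = ennreal (pos e)"
      by (cases "F (snd e) \<le> F (fst e)") (auto simp: pos_def max_def)
  qed
  also have "\<dots> = ennreal (measure_pmf.expectation J pos)"
    using bpos by (intro nn_integral_eq_integral) (auto simp: pos_def)
  finally have "\<phi> * measure_pmf.expectation \<pi> F \<le> measure_pmf.expectation J pos"
    by (subst (asm) ennreal_le_iff) (auto simp: pos_def intro!: integral_nonneg_AE)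
  moreover have "measure_pmf.expectation J (\<lambda>(x, y). \<bar>F x - F y\<bar>)
      = measure_pmf.expectation J (\<lambda>e. 2 * pos e - (F (fst e) - F (snd e)))"
    by (intro Bochner_Integration.integral_cong) (auto simp: pos_def max_def)
  moreover have "\<dots> = 2 * measure_pmf.expectation J pos"
    using integrable_bounded_fun[OF bpos, of J] integrable_bounded_fun[OF bounded_fun_comp[OF F, of fst], of J]
      integrable_bounded_fun[OF bounded_fun_comp[OF F, of snd], of J]
    by (simp add: expectation_edge_fst expectation_edge_snd)
  ultimately show ?thesis by simp
qed

end

locale lazy_chain = stationary_chain +
  assumes lazy: "\<And>x. pmf (P x) x \<ge> 1/2"
begin

text \<open>Pointwise, \<open>E f(Y)\<^sup>2 - (E f(Y))\<^sup>2\<close> is the variance of \<open>f(Y)\<close> given \<open>X = x\<close>, and laziness bounds it below by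
half of \<open>E (f(Y) - f(x))\<^sup>2\<close>; averaging over \<open>x\<close> turns this into the Dirichlet form.\<close>

lemma transition_op_energy:
  assumes f: "bounded_fun f"
  shows "measure_pmf.expectation \<pi> (\<lambda>x. (T f x)\<^sup>2)
    \<le> measure_pmf.expectation \<pi> (\<lambda>x. (f x)\<^sup>2) - dirichlet P \<pi> f"
proof -
  define V where "V x = measure_pmf.expectation (P x) (\<lambda>y. (f x - f y)\<^sup>2)" for x
  have bd: "bounded_fun (\<lambda>e. (f (fst e) - f (snd e))\<^sup>2)"
    by (intro bounded_fun_power2 bounded_fun_diff bounded_fun_comp[OF f])
  have bV: "bounded_fun V"
  proof -
    obtain C where C: "\<bar>(f x - f y)\<^sup>2\<bar> \<le> C" for x y
      using bd unfolding bounded_fun_def by (metis fst_conv snd_conv)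
    have "\<bar>V x\<bar> \<le> C" for x
    proof -
      have "\<bar>V x\<bar> \<le> measure_pmf.expectation (P x) (\<lambda>y. \<bar>(f x - f y)\<^sup>2\<bar>)"
        unfolding V_def by (rule integral_abs_bound)
      also have "\<dots> \<le> measure_pmf.expectation (P x) (\<lambda>y. C)"
        by (rule integral_mono) (use C in \<open>auto intro!: integrable_bounded_fun bounded_funI[of _ C]\<close>)
      finally show ?thesis by simp
    qed
    then show ?thesis by (rule bounded_funI)
  qed
  have pt: "(T f x)\<^sup>2 \<le> T (\<lambda>y. (f y)\<^sup>2) x - V x / 2" for x
  proof -
    define d where "d y = f y - f x" for y
    have d: "bounded_fun d" unfolding d_def by (intro bounded_fun_diff f bounded_fun_const)
    note i = integrable_bounded_fun[OF f, of "P x"] integrable_bounded_fun[OF d, of "P x"]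
      integrable_bounded_fun[OF bounded_fun_power2[OF d], of "P x"]
    define m where "m = measure_pmf.expectation (P x) d"
    define s where "s = measure_pmf.expectation (P x) (\<lambda>y. (d y)\<^sup>2)"
    have "T f x = m + f x"
      using i(1) by (simp add: m_def d_def[abs_def] transition_op_def)
    moreover have "T (\<lambda>y. (f y)\<^sup>2) x = s + 2 * f x * m + (f x)\<^sup>2"
    proof -
      have "T (\<lambda>y. (f y)\<^sup>2) x = measure_pmf.expectation (P x) (\<lambda>y. (d y)\<^sup>2 + 2 * f x * d y + (f x)\<^sup>2)"
        unfolding transition_op_def d_def
        by (intro Bochner_Integration.integral_cong) (auto simp: power2_eq_square algebra_simps)
      then show ?thesis using i by (simp add: s_def m_def)
    qed
    moreover have "V x = s" by (simp add: V_def s_def d_def power2_commute)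
    moreover have "2 * m\<^sup>2 \<le> s"
      unfolding m_def s_def by (rule square_expectation_le_of_atom[OF d _ lazy]) (simp add: d_def)
    ultimately show ?thesis by (simp add: power2_eq_square algebra_simps)
  qed
  have bT: "bounded_fun (T (\<lambda>y. (f y)\<^sup>2))" "bounded_fun (\<lambda>x. (T f x)\<^sup>2)" using f by auto
  have "measure_pmf.expectation \<pi> (\<lambda>x. (T f x)\<^sup>2)
      \<le> measure_pmf.expectation \<pi> (\<lambda>x. T (\<lambda>y. (f y)\<^sup>2) x - V x / 2)"
    by (intro integral_mono integrable_bounded_fun bounded_fun_diff bounded_fun_divide bT bV pt)
  also have "\<dots> = measure_pmf.expectation \<pi> (\<lambda>x. (f x)\<^sup>2) - measure_pmf.expectation \<pi> V / 2"
    using integrable_bounded_fun[OF bT(1), of \<pi>] integrable_bounded_fun[OF bV, of \<pi>] f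
    by (simp add: expectation_transition_op bounded_fun_power2)
  also have "measure_pmf.expectation \<pi> V / 2 = dirichlet P \<pi> f"
    unfolding dirichlet_def V_def using expectation_edge_pmf[OF bd, of P \<pi>] by (simp add: split_def)
  finally show ?thesis .
qed

text \<open>By laziness at least half of the mass of \<open>F X + F Y\<close> sits on the diagonal, where it contributes nothing
to the Dirichlet form. The factor 2 so gained in Cheeger's inequality is what makes the final constants
come out as stated.\<close>

lemma expectation_off_diagonal:
  assumes F: "bounded_fun F" and nonneg: "\<And>x. 0 \<le> F x"
  shows "measure_pmf.expectation J (\<lambda>(x, y). (if x = y then 0 else F x + F y)) \<le> measure_pmf.expectation \<pi> F"
proof -
  have b1: "bounded_fun (\<lambda>e. F (fst e))" "bounded_fun (\<lambda>e. F (snd e))" "bounded_fun (\<lambda>e. indicator Id e * F (fst e))"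
    for e :: "'v \<times> 'v" by (auto intro: bounded_fun_comp[OF F] bounded_fun_indicator)
  have d: "measure_pmf.expectation (P x) (\<lambda>y. indicator Id (x, y) * F x) = pmf (P x) x * F x" for x
  proof -
    have "measure_pmf.expectation (P x) (\<lambda>y. indicator Id (x, y) * F x)
        = measure_pmf.expectation (P x) (\<lambda>y. indicator {x} y * F x)"
      by (intro Bochner_Integration.integral_cong) (auto simp: indicator_def)
    then show ?thesis by (simp add: pmf.rep_eq)
  qed
  have half: "F x / 2 \<le> pmf (P x) x * F x" for x
    using mult_right_mono[OF lazy nonneg, of x x] by simp
  have bp: "bounded_fun (\<lambda>x. pmf (P x) x)"
    by (rule bounded_funI[of _ 1]) (simp add: pmf_le_1)
  have "measure_pmf.expectation \<pi> F / 2 = measure_pmf.expectation \<pi> (\<lambda>x. F x / 2)" by simp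
  also have "\<dots> \<le> measure_pmf.expectation \<pi> (\<lambda>x. pmf (P x) x * F x)"
    by (intro integral_mono half integrable_bounded_fun bounded_fun_divide bounded_fun_mult bp F)
  also have "\<dots> = measure_pmf.expectation \<pi> (\<lambda>x. measure_pmf.expectation (P x) (\<lambda>y. indicator Id (x, y) * F x))"
    by (simp only: d)
  also have "\<dots> = measure_pmf.expectation J (\<lambda>e. indicator Id e * F (fst e))"
    using expectation_edge_pmf[OF b1(3), of P \<pi>] by simp
  finally have *: "measure_pmf.expectation \<pi> F / 2 \<le> measure_pmf.expectation J (\<lambda>e. indicator Id e * F (fst e))" .
  have "measure_pmf.expectation J (\<lambda>(x, y). (if x = y then 0 else F x + F y))
      = measure_pmf.expectation J (\<lambda>e. F (fst e) + F (snd e) - 2 * (indicator Id e * F (fst e)))"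
    by (intro Bochner_Integration.integral_cong) auto
  also have "\<dots> = 2 * measure_pmf.expectation \<pi> F - 2 * measure_pmf.expectation J (\<lambda>e. indicator Id e * F (fst e))"
    using b1[THEN integrable_bounded_fun, of J] by (simp add: expectation_edge_fst expectation_edge_snd)
  finally show ?thesis using * by simp
qed

text \<open>Apply the layer cake bound to \<open>f\<^sup>2\<close> and factor \<open>f(X)\<^sup>2 - f(Y)\<^sup>2\<close>. Instead of Cauchy-Schwarz, the weighted
inequality \<open>2 \<phi> \<bar>a b\<bar> \<le> a\<^sup>2 + \<phi>\<^sup>2 b\<^sup>2\<close> is used pointwise.\<close>

lemma cheeger_dirichlet:
  assumes f: "bounded_fun f" and nonneg: "\<And>x. 0 \<le> f x" and \<phi>: "0 \<le> \<phi>"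
    and level: "\<And>t. 0 \<le> t \<Longrightarrow> \<phi> * measure_pmf.prob \<pi> {x. t < f x}
                  \<le> measure_pmf.prob J ({x. t < f x} \<times> - {x. t < f x})"
  shows "\<phi>\<^sup>2 * measure_pmf.expectation \<pi> (\<lambda>x. (f x)\<^sup>2) \<le> dirichlet P \<pi> f"
proof (cases "\<phi> = 0")
  case True
  then show ?thesis by (simp add: dirichlet_nonneg)
next
  case False
  define W where "W = measure_pmf.expectation \<pi> (\<lambda>x. (f x)\<^sup>2)"
  define a where "a e = (f (fst e) - f (snd e))\<^sup>2" for e
  define b where "b e = (if fst e = snd e then 0 else (f (fst e))\<^sup>2 + (f (snd e))\<^sup>2)" for e
  have f2: "bounded_fun (\<lambda>x. (f x)\<^sup>2)" using f by auto
  have ba: "bounded_fun a"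
    unfolding a_def by (intro bounded_fun_power2 bounded_fun_diff bounded_fun_comp[OF f])
  have bb: "bounded_fun b"
  proof -
    have "b = (\<lambda>e. indicator (-Id) e * ((f (fst e))\<^sup>2 + (f (snd e))\<^sup>2))"
      by (auto simp: b_def indicator_def)
    moreover have "bounded_fun (\<lambda>e. indicator (-Id) e * ((f (fst e))\<^sup>2 + (f (snd e))\<^sup>2))"
      by (intro bounded_fun_mult bounded_fun_indicator bounded_fun_add bounded_fun_power2 bounded_fun_comp[OF f])
    ultimately show ?thesis by simp
  qed
  have Ea: "measure_pmf.expectation J a = 2 * dirichlet P \<pi> f"
    by (simp add: dirichlet_def a_def[abs_def] split_def)
  have Eb: "measure_pmf.expectation J b \<le> W"
    using expectation_off_diagonal[OF f2] by (simp add: b_def[abs_def] W_def split_def)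
  have "2 * \<phi> * W \<le> measure_pmf.expectation J (\<lambda>(x, y). \<bar>(f x)\<^sup>2 - (f y)\<^sup>2\<bar>)"
    unfolding W_def
  proof (rule coarea_lower_bound[OF f2 _ \<phi>])
    fix t :: real assume t: "0 \<le> t"
    have "sqrt t < f x \<longleftrightarrow> t < (f x)\<^sup>2" for x
      using real_sqrt_less_iff[of t "(f x)\<^sup>2"] nonneg[of x] by simp
    then have "{x. t < (f x)\<^sup>2} = {x. sqrt t < f x}" by simp
    then show "\<phi> * measure_pmf.prob \<pi> {x. t < (f x)\<^sup>2}
        \<le> measure_pmf.prob J ({x. t < (f x)\<^sup>2} \<times> - {x. t < (f x)\<^sup>2})"
      using level[of "sqrt t"] t by simp
  qed simp
  then have "2 * \<phi> * (2 * \<phi> * W) \<le> 2 * \<phi> * measure_pmf.expectation J (\<lambda>(x, y). \<bar>(f x)\<^sup>2 - (f y)\<^sup>2\<bar>)"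
    using \<phi> by (intro mult_left_mono) auto
  also have "\<dots> = measure_pmf.expectation J (\<lambda>e. 2 * \<phi> * \<bar>(f (fst e))\<^sup>2 - (f (snd e))\<^sup>2\<bar>)"
    by (simp add: split_def)
  also have "\<dots> \<le> measure_pmf.expectation J (\<lambda>e. a e + \<phi>\<^sup>2 * (2 * b e - a e))"
  proof (rule integral_mono)
    fix e
    \<comment> \<open>Here \<open>(r + s)\<^sup>2 = 2 (r\<^sup>2 + s\<^sup>2) - (r - s)\<^sup>2\<close>; on the diagonal both sides vanish, so \<open>b\<close> may be 0 there.\<close>
    define r s where "r = f (fst e)" and "s = f (snd e)"
    have "2 * \<phi> * \<bar>r\<^sup>2 - s\<^sup>2\<bar> = 2 * (\<phi> * \<bar>r + s\<bar>) * \<bar>r - s\<bar>"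
      by (simp add: square_diff_square_factored power2_eq_square abs_mult)
    also have "\<dots> \<le> (\<phi> * \<bar>r + s\<bar>)\<^sup>2 + \<bar>r - s\<bar>\<^sup>2"
      by (rule sum_squares_bound)
    also have "\<dots> = (r - s)\<^sup>2 + \<phi>\<^sup>2 * (2 * (r\<^sup>2 + s\<^sup>2) - (r - s)\<^sup>2)"
      by (simp add: power_mult_distrib) (simp add: power2_eq_square algebra_simps)
    finally show "2 * \<phi> * \<bar>(f (fst e))\<^sup>2 - (f (snd e))\<^sup>2\<bar> \<le> a e + \<phi>\<^sup>2 * (2 * b e - a e)"
      by (cases "fst e = snd e") (simp_all add: a_def b_def r_def s_def)
  next
    have "bounded_fun (\<lambda>e. \<bar>(f (fst e))\<^sup>2 - (f (snd e))\<^sup>2\<bar>)"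
    proof -
      have "bounded_fun (\<lambda>e. (f (fst e))\<^sup>2 - (f (snd e))\<^sup>2)"
        by (intro bounded_fun_diff bounded_fun_power2 bounded_fun_comp[OF f])
      then show ?thesis by (simp add: bounded_fun_def)
    qed
    then show "integrable J (\<lambda>e. 2 * \<phi> * \<bar>(f (fst e))\<^sup>2 - (f (snd e))\<^sup>2\<bar>)"
      by (intro integrable_bounded_fun bounded_fun_mult bounded_fun_const)
    show "integrable J (\<lambda>e. a e + \<phi>\<^sup>2 * (2 * b e - a e))"
      using ba bb by (intro integrable_bounded_fun bounded_fun_mult bounded_fun_const bounded_fun_add bounded_fun_diff)
  qed
  also have "\<dots> = 2 * dirichlet P \<pi> f + \<phi>\<^sup>2 * (2 * measure_pmf.expectation J b - 2 * dirichlet P \<pi> f)"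
    using ba[THEN integrable_bounded_fun, of J] bb[THEN integrable_bounded_fun, of J] by (simp add: Ea)
  also have "\<dots> \<le> 2 * dirichlet P \<pi> f + \<phi>\<^sup>2 * (2 * W - 0)"
    using Eb dirichlet_nonneg[of f] by (intro add_left_mono mult_left_mono) auto
  finally have "\<phi>\<^sup>2 * W \<le> dirichlet P \<pi> f"
    by (simp add: power2_eq_square algebra_simps)
  then show ?thesis by (simp add: W_def)
qed

end

section \<open>A Poincare inequality from the conductance profile\<close>

text \<open>The supremum of the \<open>t\<close> with \<open>p {f < t} \<le> 1/2\<close> works on both sides, by continuity of \<open>p\<close> from below.\<close>

lemma median_exists:
  fixes f :: "'a \<Rightarrow> real"
  assumes "bounded_fun f"
  obtains c where "measure_pmf.prob p {x. f x < c} \<le> 1/2" "measure_pmf.prob p {x. c < f x} \<le> 1/2"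
proof -
  obtain C where C: "\<And>x. \<bar>f x\<bar> \<le> C" using assms by (auto simp: bounded_fun_def)
  define A where "A = {t. measure_pmf.prob p {x. f x < t} \<le> 1/2}"
  have ne: "- C \<in> A"
  proof -
    have "{x. f x < - C} = {}" using C by (auto simp: abs_le_iff not_less) (meson abs_le_iff minus_le_iff)
    then show ?thesis by (simp add: A_def)
  qed
  have bdd: "bdd_above A"
  proof (rule bdd_aboveI[of _ C])
    fix t assume "t \<in> A"
    show "t \<le> C"
    proof (rule ccontr)
      assume "\<not> t \<le> C"
      then have "{x. f x < t} = UNIV" using C by (auto simp: abs_le_iff) (meson le_less_trans not_le)
      with \<open>t \<in> A\<close> show False by (simp add: A_def)
    qed
  qed
  define c where "c = Sup A"
  have below: "measure_pmf.prob p {x. f x < t} \<le> 1/2" if "t < c" for t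
  proof -
    have tc: "t < Sup A" using that by (simp add: c_def)
    have "A \<noteq> {}" using ne by auto
    then obtain a where "a \<in> A" "t < a"
      using tc less_cSup_iff[OF _ bdd, of t] by auto
    have "measure_pmf.prob p {x. f x < t} \<le> measure_pmf.prob p {x. f x < a}"
      using \<open>t < a\<close> by (intro measure_pmf.finite_measure_mono) auto
    with \<open>a \<in> A\<close> show ?thesis by (simp add: A_def)
  qed
  have above: "measure_pmf.prob p {x. t \<le> f x} \<le> 1/2" if "c < t" for t
  proof -
    have "t \<notin> A" using that cSup_upper[OF _ bdd, of t] unfolding c_def by auto
    moreover have "{x. t \<le> f x} = UNIV - {x. f x < t}" by auto
    ultimately show ?thesis using measure_pmf.prob_compl[of "{x. f x < t}" p] by (simp add: A_def)
  qed
  have lim: "(\<lambda>n. inverse (real (Suc n))) \<longlonglongrightarrow> 0" by (rule LIMSEQ_inverse_real_of_nat)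
  have "measure_pmf.prob p {x. f x < c} \<le> 1/2"
  proof -
    define B where "B n = {x. f x < c - inverse (real (Suc n))}" for n
    have "incseq B"
      by (intro incseq_SucI) (auto simp: B_def elim!: less_le_trans intro!: le_imp_inverse_le)
    then have "(\<lambda>n. measure_pmf.prob p (B n)) \<longlonglongrightarrow> measure_pmf.prob p (\<Union>n. B n)"
      by (intro measure_pmf.finite_Lim_measure_incseq) auto
    moreover have "(\<Union>n. B n) = {x. f x < c}"
    proof (intro set_eqI iffI)
      fix x assume "x \<in> {x. f x < c}"
      then obtain n where "inverse (real (Suc n)) < c - f x"
        using reals_Archimedean[of "c - f x"] by auto
      then show "x \<in> (\<Union>n. B n)" by (auto simp: B_def intro!: exI[of _ n])
    next
      fix x assume "x \<in> (\<Union>n. B n)"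
      then obtain n where "f x < c - inverse (real (Suc n))" by (auto simp: B_def)
      also have "\<dots> < c" by simp
      finally show "x \<in> {x. f x < c}" by simp
    qed
    ultimately have "(\<lambda>n. measure_pmf.prob p (B n)) \<longlonglongrightarrow> measure_pmf.prob p {x. f x < c}" by simp
    moreover have "measure_pmf.prob p (B n) \<le> 1/2" for n
      unfolding B_def by (rule below) simp
    ultimately show ?thesis by (blast intro: LIMSEQ_le_const2)
  qed
  moreover have "measure_pmf.prob p {x. c < f x} \<le> 1/2"
  proof -
    define B where "B n = {x. c + inverse (real (Suc n)) \<le> f x}" for n
    have "incseq B"
    proof (intro incseq_SucI subsetI)
      fix n x assume "x \<in> B n"
      moreover have "inverse (real (Suc (Suc n))) \<le> inverse (real (Suc n))" by simp
      ultimately show "x \<in> B (Suc n)" unfolding B_def mem_Collect_eq by linarith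
    qed
    then have "(\<lambda>n. measure_pmf.prob p (B n)) \<longlonglongrightarrow> measure_pmf.prob p (\<Union>n. B n)"
      by (intro measure_pmf.finite_Lim_measure_incseq) auto
    moreover have "(\<Union>n. B n) = {x. c < f x}"
    proof (intro set_eqI iffI)
      fix x assume "x \<in> {x. c < f x}"
      then obtain n where "inverse (real (Suc n)) < f x - c"
        using reals_Archimedean[of "f x - c"] by auto
      then show "x \<in> (\<Union>n. B n)" by (auto simp: B_def intro!: exI[of _ n])
    next
      fix x assume "x \<in> (\<Union>n. B n)"
      then obtain n where n: "c + inverse (real (Suc n)) \<le> f x" by (auto simp: B_def)
      have "c < c + inverse (real (Suc n))" by simp
      also note n
      finally show "x \<in> {x. c < f x}" by simp
    qed
    ultimately have "(\<lambda>n. measure_pmf.prob p (B n)) \<longlonglongrightarrow> measure_pmf.prob p {x. c < f x}" by simp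
    moreover have "measure_pmf.prob p (B n) \<le> 1/2" for n
      unfolding B_def by (rule above) simp
    ultimately show ?thesis by (blast intro: LIMSEQ_le_const2)
  qed
  ultimately show ?thesis by (rule that)
qed

definition chi_square :: "'v pmf \<Rightarrow> ('v \<Rightarrow> real) \<Rightarrow> real" where
  "chi_square \<pi> f = measure_pmf.expectation \<pi> (\<lambda>x. (f x - 1)\<^sup>2)"

lemma chi_square_nonneg: "0 \<le> chi_square \<pi> f"
  unfolding chi_square_def by (rule integral_nonneg_AE) simp

lemma chi_square_eq:
  assumes "bounded_fun f" "measure_pmf.expectation \<pi> f = 1"
  shows "chi_square \<pi> f = measure_pmf.expectation \<pi> (\<lambda>x. (f x)\<^sup>2) - 1"
proof -
  have "chi_square \<pi> f = measure_pmf.expectation \<pi> (\<lambda>x. (f x)\<^sup>2 - 2 * f x + 1)"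
    unfolding chi_square_def
    by (intro Bochner_Integration.integral_cong) (auto simp: power2_eq_square algebra_simps)
  then show ?thesis
    using assms(1)[THEN integrable_bounded_fun, of \<pi>] assms(1)[THEN bounded_fun_power2, THEN integrable_bounded_fun, of \<pi>]
    by (simp add: assms(2))
qed

context stationary_chain
begin

text \<open>The form in which the profile is used. Any real lower bound \<open>\<phi>\<close> is admitted, rather than the value of
the profile, because that value is infinite when no nonempty set is small enough.\<close>

lemma profile_level:
  assumes \<phi>: "0 \<le> \<phi>" "ennreal \<phi> \<le> conductance_profile P \<pi> r"
    and S: "measure_pmf.prob \<pi> S \<le> min r (1/2)"
  shows "\<phi> * measure_pmf.prob \<pi> S \<le> measure_pmf.prob J (S \<times> - S)"
proof (cases "measure_pmf.prob \<pi> S = 0")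
  case False
  then have "S \<noteq> {}" by auto
  with S have "conductance_profile P \<pi> r \<le> ennreal (conductance P \<pi> S)"
    unfolding conductance_profile_def by (intro INF_lower) auto
  with \<phi>(2) have "ennreal \<phi> \<le> ennreal (conductance P \<pi> S)" by (rule order_trans)
  then have "\<phi> \<le> conductance P \<pi> S"
    by (subst (asm) ennreal_le_iff) (auto simp: conductance_eq)
  moreover have "0 < measure_pmf.prob \<pi> S" using False by (simp add: zero_less_measure_iff)
  ultimately show ?thesis by (simp add: conductance_eq pos_le_divide_eq)
qed simp

lemma profile_antimono: "r \<le> s \<Longrightarrow> conductance_profile P \<pi> s \<le> conductance_profile P \<pi> r"
  unfolding conductance_profile_def by (rule INF_superset_mono) auto

end

context lazy_chain
begin

lemma dirichlet_truncation:
  assumes f: "bounded_fun f" and \<phi>: "0 \<le> \<phi>" "ennreal \<phi> \<le> conductance_profile P \<pi> r"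
    and small: "measure_pmf.prob \<pi> {x. 0 < f x} \<le> min r (1/2)"
  shows "\<phi>\<^sup>2 * measure_pmf.expectation \<pi> (\<lambda>x. (max (f x) 0)\<^sup>2) \<le> dirichlet P \<pi> (\<lambda>x. max (f x) 0)"
proof (rule cheeger_dirichlet)
  fix t :: real assume "0 \<le> t"
  have "measure_pmf.prob \<pi> {x. t < max (f x) 0} \<le> measure_pmf.prob \<pi> {x. 0 < f x}"
    using \<open>0 \<le> t\<close> by (intro measure_pmf.finite_measure_mono) auto
  also note small
  finally show "\<phi> * measure_pmf.prob \<pi> {x. t < max (f x) 0}
      \<le> measure_pmf.prob J ({x. t < max (f x) 0} \<times> - {x. t < max (f x) 0})"
    by (rule profile_level[OF \<phi>])
qed (use f \<phi> in auto)

text \<open>If \<open>4 / V \<le> 1/2\<close>, the set \<open>{f > V / 4}\<close> has measure at most \<open>4 / V\<close> by Markov's inequality, and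
\<open>E ((f - c)\<^sup>+)\<^sup>2 \<ge> E f\<^sup>2 - 2 c E f = V + 1 - 2 c\<close> is at least \<open>V / 2\<close> for \<open>c = V / 4\<close>. Otherwise the profile
bounds the conductance of all sets of measure up to 1/2, and the positive and negative parts of \<open>f\<close>
minus its median are both supported on such sets.\<close>

lemma poincare_profile:
  assumes f: "bounded_fun f" and nonneg: "\<And>x. 0 \<le> f x" and mean: "measure_pmf.expectation \<pi> f = 1"
    and pos: "0 < chi_square \<pi> f"
    and \<phi>: "0 \<le> \<phi>" "ennreal \<phi> \<le> conductance_profile P \<pi> (4 / chi_square \<pi> f)"
  shows "\<phi>\<^sup>2 / 2 * chi_square \<pi> f \<le> dirichlet P \<pi> f"
proof -
  define V where "V = chi_square \<pi> f"
  note int = integrable_bounded_fun[OF f, of \<pi>] integrable_bounded_fun[OF bounded_fun_power2[OF f], of \<pi>]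
  have E2: "measure_pmf.expectation \<pi> (\<lambda>x. (f x)\<^sup>2) = V + 1"
    using chi_square_eq[OF f mean] by (simp add: V_def)
  show ?thesis
  proof (cases "4 / V \<le> 1/2")
    case True
    define c where "c = V / 4"
    have c: "0 < c" using pos by (simp add: c_def V_def)
    have bc: "bounded_fun (\<lambda>x. f x - c)" using f by auto
    have "c * measure_pmf.prob \<pi> {x. c < f x} = measure_pmf.expectation \<pi> (\<lambda>x. c * indicator {x. c < f x} x)"
      by simp
    also have "\<dots> \<le> measure_pmf.expectation \<pi> f"
      by (intro integral_mono integrable_bounded_fun bounded_fun_mult bounded_fun_const bounded_fun_indicator f)
         (auto simp: indicator_def nonneg)
    finally have "measure_pmf.prob \<pi> {x. 0 < f x - c} \<le> min (4 / V) (1/2)"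
      using True c pos by (simp add: mean c_def V_def field_simps)
    then have "\<phi>\<^sup>2 * measure_pmf.expectation \<pi> (\<lambda>x. (max (f x - c) 0)\<^sup>2)
        \<le> dirichlet P \<pi> (\<lambda>x. max (f x - c) 0)"
      by (rule dirichlet_truncation[OF bc \<phi>[folded V_def]])
    also have "\<dots> \<le> dirichlet P \<pi> f"
      using f bc by (intro dirichlet_mono bounded_fun_max bounded_fun_const) auto
    finally have *: "\<phi>\<^sup>2 * measure_pmf.expectation \<pi> (\<lambda>x. (max (f x - c) 0)\<^sup>2) \<le> dirichlet P \<pi> f" .
    have "V / 2 \<le> (V + 1) - 2 * c" by (simp add: c_def)
    also have "\<dots> = measure_pmf.expectation \<pi> (\<lambda>x. (f x)\<^sup>2 - 2 * c * f x)"
      using int by (simp add: E2 mean)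
    also have "\<dots> \<le> measure_pmf.expectation \<pi> (\<lambda>x. (max (f x - c) 0)\<^sup>2)"
    proof (intro integral_mono)
      fix x show "(f x)\<^sup>2 - 2 * c * f x \<le> (max (f x - c) 0)\<^sup>2"
      proof (cases "c \<le> f x")
        case True
        then have "max (f x - c) 0 = f x - c" by simp
        then show ?thesis by (simp add: power2_diff)
      next
        case False
        have "f x * f x \<le> c * f x" using False nonneg[of x] by (intro mult_right_mono) auto
        moreover have "0 \<le> c * f x" using c nonneg[of x] by auto
        ultimately show ?thesis using False by (simp add: max_def power2_eq_square)
      qed
    qed (intro integrable_bounded_fun bounded_fun_diff bounded_fun_power2 bounded_fun_mult
        bounded_fun_max bounded_fun_const f)+
    finally have "\<phi>\<^sup>2 * (V / 2) \<le> \<phi>\<^sup>2 * measure_pmf.expectation \<pi> (\<lambda>x. (max (f x - c) 0)\<^sup>2)"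
      by (intro mult_left_mono) auto
    with * show ?thesis by (simp add: V_def)
  next
    case False
    obtain c where c: "measure_pmf.prob \<pi> {x. f x < c} \<le> 1/2" "measure_pmf.prob \<pi> {x. c < f x} \<le> 1/2"
      using median_exists[OF f] by blast
    define u where "u x = max (f x - c) 0" for x
    define l where "l x = max (c - f x) 0" for x
    have bu: "bounded_fun u" and bl: "bounded_fun l"
      unfolding u_def l_def
      by (intro bounded_fun_max bounded_fun_diff bounded_fun_const f)+
    have Du: "\<phi>\<^sup>2 * measure_pmf.expectation \<pi> (\<lambda>x. (u x)\<^sup>2) \<le> dirichlet P \<pi> u"
      unfolding u_def using c(2) False f by (intro dirichlet_truncation[OF _ \<phi>[folded V_def]]) auto
    have Dl: "\<phi>\<^sup>2 * measure_pmf.expectation \<pi> (\<lambda>x. (l x)\<^sup>2) \<le> dirichlet P \<pi> l"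
      unfolding l_def using c(1) False f by (intro dirichlet_truncation[OF _ \<phi>[folded V_def]]) auto
    have bd: "bounded_fun (\<lambda>e. (h (fst e) - h (snd e))\<^sup>2)" if "bounded_fun h" for h :: "'v \<Rightarrow> real"
      by (intro bounded_fun_power2 bounded_fun_diff bounded_fun_comp[OF that])
    have "measure_pmf.expectation J (\<lambda>e. (u (fst e) - u (snd e))\<^sup>2) + measure_pmf.expectation J (\<lambda>e. (l (fst e) - l (snd e))\<^sup>2)
        = measure_pmf.expectation J (\<lambda>e. (u (fst e) - u (snd e))\<^sup>2 + (l (fst e) - l (snd e))\<^sup>2)"
      using bd[OF bu, THEN integrable_bounded_fun, of J] bd[OF bl, THEN integrable_bounded_fun, of J] by simp
    also have "\<dots> \<le> measure_pmf.expectation J (\<lambda>e. (f (fst e) - f (snd e))\<^sup>2)"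
    proof (intro integral_mono integrable_bounded_fun bounded_fun_add bd bu bl f)
      have split: "(max a 0 - max b 0)\<^sup>2 + (max (- a) 0 - max (- b) 0)\<^sup>2 \<le> (a - b)\<^sup>2" for a b :: real
        by (auto simp: max_def power2_diff mult_nonpos_nonneg mult_nonneg_nonpos not_le less_imp_le)
      fix e show "(u (fst e) - u (snd e))\<^sup>2 + (l (fst e) - l (snd e))\<^sup>2 \<le> (f (fst e) - f (snd e))\<^sup>2"
        using split[of "f (fst e) - c" "f (snd e) - c"] by (simp add: u_def l_def)
    qed
    finally have D: "dirichlet P \<pi> u + dirichlet P \<pi> l \<le> dirichlet P \<pi> f"
      by (simp add: dirichlet_def split_def)
    have "V \<le> V + (1 - c)\<^sup>2" by simp
    also have "\<dots> = measure_pmf.expectation \<pi> (\<lambda>x. (f x)\<^sup>2 - 2 * c * f x + c\<^sup>2)"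
      using int by (simp add: E2 mean power2_diff)
    also have "\<dots> = measure_pmf.expectation \<pi> (\<lambda>x. (u x)\<^sup>2 + (l x)\<^sup>2)"
      by (intro Bochner_Integration.integral_cong) (auto simp: u_def l_def max_def power2_eq_square algebra_simps)
    also have "\<dots> = measure_pmf.expectation \<pi> (\<lambda>x. (u x)\<^sup>2) + measure_pmf.expectation \<pi> (\<lambda>x. (l x)\<^sup>2)"
      using bu[THEN bounded_fun_power2, THEN integrable_bounded_fun, of \<pi>]
        bl[THEN bounded_fun_power2, THEN integrable_bounded_fun, of \<pi>] by simp
    finally have "\<phi>\<^sup>2 * V \<le> \<phi>\<^sup>2 * \<dots>" by (intro mult_left_mono) auto
    with Du Dl D have "\<phi>\<^sup>2 * V \<le> dirichlet P \<pi> f" by (simp add: algebra_simps)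
    moreover have "\<phi>\<^sup>2 / 2 * V \<le> \<phi>\<^sup>2 * V" using pos by (simp add: V_def)
    ultimately show ?thesis unfolding V_def by linarith
  qed
qed

lemma chi_square_transition_op:
  assumes f: "bounded_fun f" and mean: "measure_pmf.expectation \<pi> f = 1"
  shows "chi_square \<pi> (T f) \<le> chi_square \<pi> f - dirichlet P \<pi> f"
  using transition_op_energy[OF f] chi_square_eq[OF f mean]
    chi_square_eq[OF transition_op_bounded[OF f, of P]] expectation_transition_op[OF f]
  by (simp add: mean)

end

section \<open>Densities of the chain\<close>

definition point_density :: "'v pmf \<Rightarrow> 'v \<Rightarrow> 'v \<Rightarrow> real" where
  "point_density \<pi> y z = indicator {y} z / pmf \<pi> y"

lemma bounded_fun_point_density: "bounded_fun (point_density \<pi> y)"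
  unfolding point_density_def by (intro bounded_fun_divide bounded_fun_indicator)

lemma point_density_nonneg: "0 \<le> point_density \<pi> y z"
  by (simp add: point_density_def)

lemma expectation_point_density:
  assumes "0 < pmf \<pi> y"
  shows "measure_pmf.expectation \<pi> (point_density \<pi> y) = 1"
proof -
  have "measure_pmf.expectation \<pi> (\<lambda>z. indicator {y} z / pmf \<pi> y) = 1"
    using assms by (simp add: pmf.rep_eq)
  then show ?thesis by (simp add: point_density_def[abs_def])
qed

lemma expectation_point_density_mult:
  assumes "0 < pmf \<pi> y"
  shows "measure_pmf.expectation \<pi> (\<lambda>z. point_density \<pi> y z * f z) = f y"
proof -
  have "measure_pmf.expectation \<pi> (\<lambda>z. point_density \<pi> y z * f z)
      = (\<Sum>z\<in>{y}. pmf \<pi> z *\<^sub>R (point_density \<pi> y z * f z))"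
    by (rule integral_measure_pmf) (auto simp: point_density_def indicator_def split: if_splits)
  then show ?thesis using assms by (simp add: point_density_def)
qed

lemma chi_square_point_density:
  assumes "0 < pmf \<pi> y"
  shows "chi_square \<pi> (point_density \<pi> y) = 1 / pmf \<pi> y - 1"
proof -
  have "measure_pmf.expectation \<pi> (\<lambda>z. (point_density \<pi> y z)\<^sup>2) = point_density \<pi> y y"
    unfolding power2_eq_square by (rule expectation_point_density_mult[OF assms])
  then show ?thesis
    by (simp add: chi_square_eq bounded_fun_point_density expectation_point_density assms)
       (simp add: point_density_def)
qed

lemma inverse_ennreal_antimono: "a \<le> b \<Longrightarrow> inverse b \<le> inverse (a :: ennreal)"
  including ennreal.lifting by transfer (rule ereal_inverse_antimono)

context stationary_chain
begin

lemma dirichlet_point_density: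
  "dirichlet P \<pi> (point_density \<pi> y) = measure_pmf.prob J ({y} \<times> - {y}) / (pmf \<pi> y)\<^sup>2"
proof -
  have "measure_pmf.expectation J (\<lambda>(z, w). (point_density \<pi> y z - point_density \<pi> y w)\<^sup>2)
      = measure_pmf.expectation J (\<lambda>e. (indicator ({y} \<times> - {y}) e + indicator ((- {y}) \<times> {y}) e) / (pmf \<pi> y)\<^sup>2)"
    by (intro Bochner_Integration.integral_cong)
       (auto simp: point_density_def indicator_def power_divide)
  also have "\<dots> = (measure_pmf.prob J ({y} \<times> - {y}) + measure_pmf.prob J ((- {y}) \<times> {y})) / (pmf \<pi> y)\<^sup>2"
    using integrable_bounded_fun[OF bounded_fun_indicator, of J "{y} \<times> - {y}"]
      integrable_bounded_fun[OF bounded_fun_indicator, of J "(- {y}) \<times> {y}"] by simp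
  finally show ?thesis by (simp add: dirichlet_def prob_edge_compl_swap)
qed

lemma transition_op_nonneg: "(\<And>x. 0 \<le> f x) \<Longrightarrow> 0 \<le> T f x"
  unfolding transition_op_def by (rule integral_nonneg_AE) simp

lemma iterated_density:
  assumes "0 < pmf \<pi> y"
  shows "bounded_fun ((T ^^ m) (point_density \<pi> y))"
    and "0 \<le> (T ^^ m) (point_density \<pi> y) z"
    and "measure_pmf.expectation \<pi> ((T ^^ m) (point_density \<pi> y)) = 1"
proof -
  show b: "bounded_fun ((T ^^ m) (point_density \<pi> y))" for m
    by (induction m) (auto simp: bounded_fun_point_density)
  show "0 \<le> (T ^^ m) (point_density \<pi> y) z" for z
    by (induction m arbitrary: z) (auto simp: point_density_nonneg intro: transition_op_nonneg)
  show "measure_pmf.expectation \<pi> ((T ^^ m) (point_density \<pi> y)) = 1"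
    using assms by (induction m) (simp_all add: expectation_point_density expectation_transition_op b)
qed

section \<open>The profile integral\<close>

text \<open>A monotone function; the superlevel sets are intervals. Measurability is needed to add up the
integrals over consecutive intervals.\<close>

lemma borel_measurable_profile [measurable]: "conductance_profile P \<pi> \<in> borel_measurable borel"
proof (rule borel_measurableI_greater)
  fix t
  have "is_interval {r. t < conductance_profile P \<pi> r}"
    unfolding is_interval_1 by (auto intro: less_le_trans profile_antimono)
  then show "{r \<in> space borel. t < conductance_profile P \<pi> r} \<in> sets borel"
    by (simp add: real_interval_borel_measurable)
qed

lemma profile_integral_split:
  assumes "A \<le> B" "B \<le> C"
  shows "profile_integral P \<pi> A B + profile_integral P \<pi> B C \<le> profile_integral P \<pi> A C"
proof -
  define k where "k u = 4 / (ennreal u * (conductance_profile P \<pi> u)\<^sup>2)" for u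
  have [measurable]: "k \<in> borel_measurable lborel" unfolding k_def by measurable
  have "profile_integral P \<pi> A B + profile_integral P \<pi> B C
      = (\<integral>\<^sup>+u. k u * indicator {A<..<B} u + k u * indicator {B<..<C} u \<partial>lborel)"
    unfolding profile_integral_def k_def[symmetric] by (subst nn_integral_add) auto
  also have "\<dots> \<le> profile_integral P \<pi> A C"
    unfolding profile_integral_def k_def[symmetric]
    using assms by (intro nn_integral_mono) (auto simp: indicator_def)
  finally show ?thesis .
qed

lemma profile_integral_mono:
  assumes "A' \<le> A" "B \<le> B'"
  shows "profile_integral P \<pi> A B \<le> profile_integral P \<pi> A' B'"
  unfolding profile_integral_def using assms
  by (intro nn_integral_mono) (auto simp: indicator_def)

lemma profile_integral_lower:
  assumes cd: "0 < c" "c \<le> d" and \<phi>: "0 < \<phi>" "conductance_profile P \<pi> c \<le> ennreal \<phi>"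
  shows "ennreal (4 / \<phi>\<^sup>2 * ln (d / c)) \<le> profile_integral P \<pi> c d"
proof -
  have "ennreal (4 / \<phi>\<^sup>2 * ln (d / c)) = ennreal (4 / \<phi>\<^sup>2 * ln d - 4 / \<phi>\<^sup>2 * ln c)"
    using cd by (simp add: ln_div right_diff_distrib)
  also have "\<dots> = (\<integral>\<^sup>+u. ennreal (4 / (u * \<phi>\<^sup>2)) * indicator {c..d} u \<partial>lborel)"
    using cd \<phi> by (intro nn_integral_FTC_Icc[symmetric]) (auto intro!: derivative_eq_intros simp: field_simps)
  also have "\<dots> = (\<integral>\<^sup>+u. ennreal (4 / (u * \<phi>\<^sup>2)) * indicator {c<..<d} u \<partial>lborel)"
    using AE_lborel_singleton[of c] AE_lborel_singleton[of d]
    by (intro nn_integral_cong_AE) (auto simp: indicator_def)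
  also have "\<dots> \<le> profile_integral P \<pi> c d"
    unfolding profile_integral_def
  proof (intro nn_integral_mono)
    fix u
    show "ennreal (4 / (u * \<phi>\<^sup>2)) * indicator {c<..<d} u
        \<le> 4 / (ennreal u * (conductance_profile P \<pi> u)\<^sup>2) * indicator {c<..<d} u"
    proof (cases "u \<in> {c<..<d}")
      case True
      then have "conductance_profile P \<pi> u \<le> ennreal \<phi>"
        using profile_antimono[of c u] \<phi>(2) by auto
      then have "ennreal u * (conductance_profile P \<pi> u)\<^sup>2 \<le> ennreal u * (ennreal \<phi>)\<^sup>2"
        by (intro mult_left_mono power_mono) auto
      also have "\<dots> = ennreal (u * \<phi>\<^sup>2)"
        using True cd \<phi> by (simp add: ennreal_mult ennreal_power)
      finally have "4 / ennreal (u * \<phi>\<^sup>2) \<le> 4 / (ennreal u * (conductance_profile P \<pi> u)\<^sup>2)"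
        by (simp add: divide_ennreal_def mult_left_mono inverse_ennreal_antimono)
      moreover have "ennreal (4 / (u * \<phi>\<^sup>2)) = 4 / ennreal (u * \<phi>\<^sup>2)"
        using True cd \<phi> divide_ennreal[of 4 "u * \<phi>\<^sup>2"] by simp
      ultimately show ?thesis using True by simp
    qed simp
  qed
  finally show ?thesis .
qed

text \<open>A zero of the profile propagates to the right and would make the integrand infinite.\<close>

lemma profile_nonzero:
  assumes fin: "profile_integral P \<pi> A B < \<top>" and "A \<le> c" "c < B"
  shows "conductance_profile P \<pi> c \<noteq> 0"
proof
  assume "conductance_profile P \<pi> c = 0"
  then have zero: "conductance_profile P \<pi> u = 0" if "c < u" for u
    using profile_antimono[of c u] that by simp
  have "profile_integral P \<pi> c B = (\<integral>\<^sup>+u. \<top> * indicator {c<..<B} u \<partial>lborel)"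
    unfolding profile_integral_def by (intro nn_integral_cong) (auto simp: indicator_def zero)
  also have "\<dots> = \<top>"
    using \<open>c < B\<close> by (subst nn_integral_cmult_indicator) (auto simp: ennreal_top_mult)
  finally show False using fin profile_integral_mono[OF \<open>A \<le> c\<close> order_refl, of B] by simp
qed

end

context lazy_chain
begin

section \<open>Decay of the variance along the iteration\<close>

lemma chi_square_decay:
  assumes f: "bounded_fun f" "\<And>x. 0 \<le> f x" "measure_pmf.expectation \<pi> f = 1"
    and pos: "0 < chi_square \<pi> f"
    and \<phi>: "0 \<le> \<phi>" "ennreal \<phi> \<le> conductance_profile P \<pi> (4 / chi_square \<pi> f)"
  shows "chi_square \<pi> (T f) \<le> chi_square \<pi> f * (1 - \<phi>\<^sup>2 / 2)"
  using poincare_profile[OF f pos \<phi>] chi_square_transition_op[OF f(1,3)] by (simp add: algebra_simps)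

text \<open>The Dirichlet form of the point density at \<open>y\<close> is a single conductance divided by \<open>\<pi>(y)\<close>, so it is linear
and not quadratic in \<open>\<phi>\<close>. If \<open>\<pi>(y) > 1/2\<close>, the profile bounds the conductance of the complement of
\<open>y\<close> instead.\<close>

lemma chi_square_first_step:
  assumes y: "0 < pmf \<pi> y" and \<phi>: "0 \<le> \<phi>" "ennreal \<phi> \<le> conductance_profile P \<pi> (4 * pmf \<pi> y)"
  shows "chi_square \<pi> (T (point_density \<pi> y)) \<le> (1 / pmf \<pi> y - 1) * (1 - \<phi>)"
proof -
  define p where "p = pmf \<pi> y"
  have p: "0 < p" "p \<le> 1" using y by (auto simp: p_def pmf_le_1)
  have single: "measure_pmf.prob \<pi> {y} = p" by (simp add: p_def pmf.rep_eq)
  have compl: "measure_pmf.prob \<pi> (- {y}) = 1 - p"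
    using measure_pmf.prob_compl[of "{y}" \<pi>] by (simp add: single Compl_eq_Diff_UNIV)
  have "\<phi> * (1 / p - 1) \<le> measure_pmf.prob J ({y} \<times> - {y}) / p\<^sup>2"
  proof (cases "p \<le> 1/2")
    case True
    then have "\<phi> * p \<le> measure_pmf.prob J ({y} \<times> - {y})"
      using profile_level[OF \<phi>, of "{y}"] p by (simp add: single p_def[symmetric])
    moreover have "\<phi> * (1 / p - 1) \<le> \<phi> * p / p\<^sup>2"
      using p \<phi>(1) by (simp add: field_simps power2_eq_square)
    ultimately show ?thesis by (meson divide_right_mono order_trans zero_le_power2)
  next
    case False
    then have "\<phi> * (1 - p) \<le> measure_pmf.prob J ((- {y}) \<times> {y})"
      using profile_level[OF \<phi>, of "- {y}"] by (simp add: compl p_def[symmetric])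
    then have "\<phi> * (1 - p) \<le> measure_pmf.prob J ({y} \<times> - {y})"
      by (simp add: prob_edge_compl_swap)
    moreover have "\<phi> * (1 / p - 1) \<le> \<phi> * (1 - p) / p\<^sup>2"
    proof -
      have "p * (1 - p) \<le> 1 * (1 - p)" using p by (intro mult_right_mono) auto
      then have "p * (1 - p) / p\<^sup>2 \<le> (1 - p) / p\<^sup>2"
        by (simp add: divide_right_mono)
      moreover have "p * (1 - p) / p\<^sup>2 = 1 / p - 1"
        using p by (simp add: power2_eq_square diff_divide_distrib)
      ultimately have "1 / p - 1 \<le> (1 - p) / p\<^sup>2" by simp
      then show ?thesis using \<phi>(1) mult_left_mono by fastforce
    qed
    ultimately show ?thesis by (meson divide_right_mono order_trans zero_le_power2)
  qed
  then show ?thesis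
    using chi_square_transition_op[OF bounded_fun_point_density expectation_point_density[OF y]]
      chi_square_point_density[OF y]
    by (simp add: dirichlet_point_density p_def algebra_simps diff_divide_distrib)
qed

end

context lazy_chain
begin

section \<open>Comparing the decay with the profile integral\<close>

text \<open>The profile is at most \<open>\<phi> = \<Phi>(4 / v)\<close> on the interval from \<open>4 / v\<close> to \<open>4 / w\<close>, where \<open>w \<le> v (1 - \<phi>\<^sup>2 / 2)\<close>, so the
integral is at least \<open>(4 / \<phi>\<^sup>2) ln (v / w) \<ge> 2\<close>. Finiteness of the whole integral excludes \<open>\<phi> = 0\<close>, for which
the interval could be empty; \<open>\<phi> = \<infinity>\<close> is excluded since it would force \<open>w < 0\<close>.\<close>

lemma step_gain:
  assumes \<epsilon>: "0 < \<epsilon>" and a: "0 < a"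
    and fin: "profile_integral P \<pi> (4 * a) (4 / \<epsilon>) < \<top>"
    and f: "bounded_fun f" "\<And>x. 0 \<le> f x" "measure_pmf.expectation \<pi> f = 1"
    and v: "chi_square \<pi> f \<le> 1 / a" and v': "\<epsilon> < chi_square \<pi> (T f)"
  shows "2 \<le> profile_integral P \<pi> (4 / chi_square \<pi> f) (4 / chi_square \<pi> (T f))"
proof -
  define v where "v = chi_square \<pi> f"
  define w where "w = chi_square \<pi> (T f)"
  have wv: "w \<le> v"
    using chi_square_transition_op[OF f(1,3)] dirichlet_nonneg[of f] by (simp add: v_def w_def)
  have pos: "0 < w" "0 < v" "\<epsilon> < v" using \<epsilon> v' wv by (auto simp: w_def)
  have decay: "w \<le> v * (1 - \<phi>\<^sup>2 / 2)" if "0 \<le> \<phi>" "ennreal \<phi> \<le> conductance_profile P \<pi> (4 / v)" for \<phi>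
    using chi_square_decay[OF f] that pos unfolding v_def w_def by blast
  have "conductance_profile P \<pi> (4 / v) \<noteq> 0"
  proof (rule profile_nonzero[OF fin])
    show "4 * a \<le> 4 / v" using v a pos by (simp add: v_def[symmetric] field_simps)
    show "4 / v < 4 / \<epsilon>" using pos \<epsilon> by (intro divide_strict_left_mono) auto
  qed
  moreover have "conductance_profile P \<pi> (4 / v) \<noteq> \<top>"
  proof
    assume "conductance_profile P \<pi> (4 / v) = \<top>"
    then have "w \<le> v * (1 - 2\<^sup>2 / 2)" by (intro decay) auto
    with pos show False by simp
  qed
  ultimately obtain \<phi> where \<phi>: "0 < \<phi>" "conductance_profile P \<pi> (4 / v) = ennreal \<phi>"
    by (cases "conductance_profile P \<pi> (4 / v)") (auto simp: less_le)
  have "w / v \<le> 1 - \<phi>\<^sup>2 / 2" using decay[of \<phi>] \<phi> pos by (simp add: field_simps)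
  then have "ln (w / v) \<le> - (\<phi>\<^sup>2 / 2)" using ln_le_minus_one[of "w / v"] pos by simp
  then have "\<phi>\<^sup>2 / 2 \<le> ln ((4 / w) / (4 / v))" using pos by (simp add: ln_div)
  then have "4 / \<phi>\<^sup>2 * (\<phi>\<^sup>2 / 2) \<le> 4 / \<phi>\<^sup>2 * ln ((4 / w) / (4 / v))" by (intro mult_left_mono) auto
  then have "2 \<le> 4 / \<phi>\<^sup>2 * ln ((4 / w) / (4 / v))" using \<phi> by simp
  then have "ennreal 2 \<le> ennreal (4 / \<phi>\<^sup>2 * ln ((4 / w) / (4 / v)))" by (rule ennreal_leI)
  also have "\<dots> \<le> profile_integral P \<pi> (4 / v) (4 / w)"
    using pos wv \<phi> by (intro profile_integral_lower divide_left_mono) auto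
  finally show ?thesis by (simp add: v_def w_def)
qed

text \<open>The hypothesis \<open>\<pi>(y) < 1\<close> says that there is a second state; it makes the initial variance positive, and
hence the profile finite and at most 1.\<close>

lemma first_step_profile:
  assumes y: "0 < pmf \<pi> y" "pmf \<pi> y < 1"
    and fin: "profile_integral P \<pi> A B < \<top>" and AB: "A \<le> 4 * pmf \<pi> y" "4 * pmf \<pi> y < B"
  obtains \<phi> where "0 < \<phi>" "\<phi> \<le> 1" "conductance_profile P \<pi> (4 * pmf \<pi> y) = ennreal \<phi>"
    "chi_square \<pi> (T (point_density \<pi> y)) \<le> (1 / pmf \<pi> y) * (1 - \<phi>)"
proof -
  define v where "v = 1 / pmf \<pi> y - 1"
  define w where "w = chi_square \<pi> (T (point_density \<pi> y))"
  have v: "0 < v" using y by (simp add: v_def)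
  have w: "0 \<le> w" by (simp add: w_def chi_square_nonneg)
  have decay: "w \<le> v * (1 - \<phi>)" if "0 \<le> \<phi>" "ennreal \<phi> \<le> conductance_profile P \<pi> (4 * pmf \<pi> y)" for \<phi>
    using chi_square_first_step[OF y(1)] that unfolding v_def w_def by blast
  have "conductance_profile P \<pi> (4 * pmf \<pi> y) \<noteq> 0"
    by (rule profile_nonzero[OF fin AB])
  moreover have "conductance_profile P \<pi> (4 * pmf \<pi> y) \<noteq> \<top>"
  proof
    assume "conductance_profile P \<pi> (4 * pmf \<pi> y) = \<top>"
    then have "w \<le> v * (1 - 2)" by (intro decay) auto
    with v w show False by simp
  qed
  ultimately obtain \<phi> where \<phi>: "0 < \<phi>" "conductance_profile P \<pi> (4 * pmf \<pi> y) = ennreal \<phi>"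
    by (cases "conductance_profile P \<pi> (4 * pmf \<pi> y)") (auto simp: less_le)
  have *: "w \<le> v * (1 - \<phi>)" using decay[of \<phi>] \<phi> by simp
  have "\<phi> \<le> 1"
  proof (rule ccontr)
    assume "\<not> \<phi> \<le> 1"
    then have "v * (1 - \<phi>) < 0" using v by (intro mult_pos_neg) auto
    with * w show False by simp
  qed
  moreover have "v * (1 - \<phi>) \<le> 1 / pmf \<pi> y * (1 - \<phi>)"
    using \<open>\<phi> \<le> 1\<close> by (intro mult_right_mono) (auto simp: v_def)
  ultimately show ?thesis using that[OF \<phi>(1) _ \<phi>(2)] * unfolding w_def by linarith
qed

lemma chi_square_iterate_bound:
  assumes y: "0 < pmf \<pi> y" shows "chi_square \<pi> ((T ^^ m) (point_density \<pi> y)) \<le> 1 / pmf \<pi> y - 1"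
proof (induction m)
  case 0
  then show ?case by (simp add: chi_square_point_density y)
next
  case (Suc m)
  have "chi_square \<pi> (T ((T ^^ m) (point_density \<pi> y))) \<le> chi_square \<pi> ((T ^^ m) (point_density \<pi> y))"
    using chi_square_transition_op[OF iterated_density(1,3)[OF y]] dirichlet_nonneg
    by (smt (verit))
  with Suc show ?case by simp
qed

text \<open>After \<open>m + 1\<close> steps the integral has grown by 4 from the first step and by 2 from each of the others. It
starts at \<open>4 a\<close> with \<open>a \<le> \<pi>(y)\<close> so that the chain and its reversal, started from different
points, can share one lower limit.\<close>

lemma potential_lower_bound:
  assumes y: "0 < pmf \<pi> y" and \<epsilon>: "0 < \<epsilon>" and a: "0 < a" "a \<le> pmf \<pi> y"
    and fin: "profile_integral P \<pi> (4 * a) (4 / \<epsilon>) < \<top>"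
    and v: "\<epsilon> < chi_square \<pi> ((T ^^ Suc m) (point_density \<pi> y))"
  shows "ennreal (2 * (real m + 2)) \<le> profile_integral P \<pi> (4 * a) (4 / chi_square \<pi> ((T ^^ Suc m) (point_density \<pi> y)))"
  using v
proof (induction m)
  case 0
  define w where "w = chi_square \<pi> (T (point_density \<pi> y))"
  define p where "p = pmf \<pi> y"
  have p: "0 < p" using y by (simp add: p_def)
  have w: "\<epsilon> < w" "0 < w" using 0 \<epsilon> by (auto simp: w_def)
  have wp: "w \<le> 1 / p - 1" using chi_square_iterate_bound[OF y, of 1] by (simp add: w_def p_def)
  have "1 < 1 / p" using wp w by linarith
  then have "p < 1" using p by simp
  have "w * p < 1" using wp p by (simp add: field_simps)
  have "\<epsilon> * p < w * p" using w p by simp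
  then have "4 * p < 4 / \<epsilon>" using \<open>w * p < 1\<close> \<epsilon> by (simp add: field_simps)
  with \<open>p < 1\<close> obtain \<phi> where \<phi>: "0 < \<phi>" "\<phi> \<le> 1" "conductance_profile P \<pi> (4 * p) = ennreal \<phi>" "w \<le> 1 / p * (1 - \<phi>)"
    using first_step_profile[OF y _ fin] a unfolding p_def w_def by auto
  have "w * p \<le> 1 - \<phi>" using \<phi>(4) p by (simp add: field_simps)
  then have "ln (w * p) \<le> - \<phi>" using ln_le_minus_one[of "w * p"] w p by simp
  then have "\<phi> \<le> ln ((4 / w) / (4 * p))" using w p by (simp add: ln_div ln_mult)
  then have "4 / \<phi>\<^sup>2 * \<phi> \<le> 4 / \<phi>\<^sup>2 * ln ((4 / w) / (4 * p))" by (intro mult_left_mono) auto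
  moreover have "4 \<le> 4 / \<phi>\<^sup>2 * \<phi>" using \<phi> by (simp add: power2_eq_square pos_le_divide_eq)
  ultimately have "ennreal 4 \<le> ennreal (4 / \<phi>\<^sup>2 * ln ((4 / w) / (4 * p)))" by (intro ennreal_leI) linarith
  also have "\<dots> \<le> profile_integral P \<pi> (4 * p) (4 / w)"
    using p w \<phi> \<open>w * p < 1\<close> by (intro profile_integral_lower) (auto simp: field_simps)
  also have "\<dots> \<le> profile_integral P \<pi> (4 * a) (4 / w)"
    using a by (intro profile_integral_mono) (auto simp: p_def)
  finally show ?case by (simp add: w_def)
next
  case (Suc m)
  define f where "f = (T ^^ Suc m) (point_density \<pi> y)"
  note dens = iterated_density[OF y, of "Suc m", folded f_def]
  define v where "v = chi_square \<pi> f"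
  define w where "w = chi_square \<pi> (T f)"
  have w: "\<epsilon> < w" using Suc.prems by (simp add: w_def f_def)
  have wv: "w \<le> v"
    using chi_square_transition_op[OF dens(1,3)] dirichlet_nonneg[of f] by (simp add: v_def w_def)
  have "v \<le> 1 / pmf \<pi> y - 1"
    unfolding v_def f_def by (rule chi_square_iterate_bound[OF y])
  moreover have "1 / pmf \<pi> y \<le> 1 / a" using a by (intro divide_left_mono) auto
  ultimately have va: "v \<le> 1 / a" by simp
  have pos: "0 < w" "0 < v" using w wv \<epsilon> by auto
  have "ennreal (2 * (real m + 2)) \<le> profile_integral P \<pi> (4 * a) (4 / v)"
    using Suc.IH w wv by (simp add: v_def f_def)
  moreover have "ennreal 2 \<le> profile_integral P \<pi> (4 / v) (4 / w)"
    using step_gain[OF \<epsilon> a(1) fin dens] va w by (simp add: v_def w_def)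
  ultimately have "ennreal (2 * (real m + 2)) + ennreal 2
      \<le> profile_integral P \<pi> (4 * a) (4 / v) + profile_integral P \<pi> (4 / v) (4 / w)"
    by (rule add_mono)
  also have "\<dots> \<le> profile_integral P \<pi> (4 * a) (4 / w)"
    using va wv pos a by (intro profile_integral_split divide_left_mono) (auto simp: field_simps)
  also have "ennreal (2 * (real m + 2)) + ennreal 2 = ennreal (2 * (real (Suc m) + 2))"
    by (subst ennreal_plus[symmetric]) (auto simp: algebra_simps)
  finally show ?case by (simp add: w_def f_def)
qed

lemma chi_square_small:
  assumes y: "0 < pmf \<pi> y" and \<epsilon>: "0 < \<epsilon>" and a: "0 < a" "a \<le> pmf \<pi> y"
    and I: "profile_integral P \<pi> (4 * a) (4 / \<epsilon>) < ennreal (2 * (real m + 1))" and m: "0 < m"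
  shows "chi_square \<pi> ((T ^^ m) (point_density \<pi> y)) \<le> \<epsilon>"
proof (rule ccontr)
  define v where "v = chi_square \<pi> ((T ^^ m) (point_density \<pi> y))"
  assume "\<not> ?thesis"
  then have v: "\<epsilon> < v" by (simp add: v_def)
  obtain k where k: "m = Suc k" using m by (cases m) auto
  have fin: "profile_integral P \<pi> (4 * a) (4 / \<epsilon>) < \<top>"
    using I by (rule less_le_trans) simp
  have "ennreal (2 * (real m + 1)) \<le> profile_integral P \<pi> (4 * a) (4 / v)"
    using potential_lower_bound[OF y \<epsilon> a fin, of k] v by (simp add: v_def k add_ac)
  also have "\<dots> \<le> profile_integral P \<pi> (4 * a) (4 / \<epsilon>)"
    using v \<epsilon> by (intro profile_integral_mono divide_left_mono) auto
  finally show False using I by simp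
qed

text \<open>The case \<open>n = 1\<close>, where only one of the two densities makes a step and the other one contributes its
initial variance, at most \<open>1 / \<pi>(y)\<close> if \<open>y\<close> is the point of smaller mass. The mean of the two is at most
\<open>(1 - \<phi> / 2) / \<pi>(y)\<close>. If that exceeded \<open>\<epsilon>\<close>, the integral would be at least \<open>2 / \<phi> \<ge> 2\<close>.\<close>

lemma one_step_bound:
  assumes y: "0 < pmf \<pi> y" "pmf \<pi> y < 1" and \<epsilon>: "0 < \<epsilon>"
    and I: "profile_integral P \<pi> (4 * pmf \<pi> y) (4 / \<epsilon>) \<le> 1"
  shows "(chi_square \<pi> (T (point_density \<pi> y)) + 1 / pmf \<pi> y) / 2 \<le> \<epsilon>"
proof (rule ccontr)
  define p where "p = pmf \<pi> y"
  define w where "w = chi_square \<pi> (T (point_density \<pi> y))"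
  have p: "0 < p" using y by (simp add: p_def)
  assume "\<not> ?thesis"
  then have less: "\<epsilon> < (w + 1 / p) / 2" by (simp add: w_def p_def)
  have "w \<le> 1 / p" using chi_square_iterate_bound[OF y(1), of 1] by (simp add: w_def p_def)
  then have \<epsilon>p: "\<epsilon> * p < 1" using less p by (simp add: field_simps)
  then have "4 * p < 4 / \<epsilon>" using \<epsilon> by (simp add: field_simps)
  moreover have "profile_integral P \<pi> (4 * p) (4 / \<epsilon>) < \<top>"
    using I by (auto simp: p_def intro: le_less_trans)
  ultimately obtain \<phi> where \<phi>: "0 < \<phi>" "\<phi> \<le> 1" "conductance_profile P \<pi> (4 * p) = ennreal \<phi>" "w \<le> 1 / p * (1 - \<phi>)"
    using first_step_profile[OF y, of "4 * p" "4 / \<epsilon>"] unfolding p_def w_def by auto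
  have "\<epsilon> * p < (w + 1 / p) / 2 * p" using less p by simp
  also have "\<dots> \<le> (1 / p * (1 - \<phi>) + 1 / p) / 2 * p" using \<phi>(4) p
    by (intro mult_right_mono divide_right_mono add_right_mono) auto
  also have "\<dots> = 1 - \<phi> / 2" using p by (simp add: field_simps)
  finally have "ln (\<epsilon> * p) \<le> - (\<phi> / 2)" using ln_le_minus_one[of "\<epsilon> * p"] \<epsilon> p by simp
  then have "\<phi> / 2 \<le> ln ((4 / \<epsilon>) / (4 * p))" using \<epsilon> p by (simp add: ln_div ln_mult)
  then have "4 / \<phi>\<^sup>2 * (\<phi> / 2) \<le> 4 / \<phi>\<^sup>2 * ln ((4 / \<epsilon>) / (4 * p))" by (intro mult_left_mono) auto
  moreover have "2 \<le> 4 / \<phi>\<^sup>2 * (\<phi> / 2)" using \<phi> by (simp add: power2_eq_square field_simps)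
  ultimately have "ennreal 2 \<le> ennreal (4 / \<phi>\<^sup>2 * ln ((4 / \<epsilon>) / (4 * p)))" by (intro ennreal_leI) linarith
  also have "\<dots> \<le> profile_integral P \<pi> (4 * p) (4 / \<epsilon>)"
    using p \<epsilon> \<phi> \<epsilon>p by (intro profile_integral_lower) (auto simp: field_simps)
  also have "\<dots> \<le> ennreal 1" using I by (simp add: p_def)
  finally show False by (subst (asm) ennreal_le_iff) auto
qed

end

section \<open>Time reversal\<close>

definition reversal :: "('v \<Rightarrow> 'v pmf) \<Rightarrow> 'v pmf \<Rightarrow> 'v \<Rightarrow> 'v pmf" where
  "reversal P \<pi> z = embed_pmf (\<lambda>x. pmf \<pi> x * pmf (P x) z / pmf \<pi> z)"

context stationary_chain
begin

lemma iterated_point_density: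
  "(T ^^ n) (point_density \<pi> y) x = pmf (nstep P n x) y / pmf \<pi> y"
proof (induction n arbitrary: x)
  case 0
  then show ?case by (simp add: point_density_def pmf_return indicator_def)
next
  case (Suc n)
  then have "(T ^^ n) (point_density \<pi> y) = (\<lambda>x. pmf (nstep P n x) y / pmf \<pi> y)" by auto
  then have "(T ^^ Suc n) (point_density \<pi> y) x = T (\<lambda>x. pmf (nstep P n x) y / pmf \<pi> y) x" by simp
  also have "\<dots> = pmf (nstep P (Suc n) x) y / pmf \<pi> y" by (simp add: transition_op_def pmf_bind)
  finally show ?case .
qed

lemma nstep_Suc: "nstep P (Suc n) = (\<lambda>x. bind_pmf (P x) (nstep P n))"
  by auto

lemma bind_stationary_nstep: "bind_pmf \<pi> (nstep P n) = \<pi>"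
proof (induction n)
  case 0
  then show ?case by (simp add: bind_return_pmf')
next
  case (Suc n)
  have "bind_pmf \<pi> (nstep P (Suc n)) = bind_pmf (bind_pmf \<pi> P) (nstep P n)"
    by (simp add: bind_assoc_pmf nstep_Suc)
  then show ?case using Suc by (simp only: bind_stationary)
qed

lemma stationary_pos:
  assumes "irreducible_chain P"
  shows "0 < pmf \<pi> y"
proof -
  obtain x where x: "x \<in> set_pmf \<pi>" using set_pmf_not_empty[of \<pi>] by blast
  obtain n where "0 < pmf (nstep P n x) y" using assms by (auto simp: irreducible_chain_def)
  then have "y \<in> set_pmf (bind_pmf \<pi> (nstep P n))"
    using x by (auto simp: set_pmf_iff intro!: bexI[of _ x])
  then show ?thesis by (simp add: bind_stationary_nstep pmf_positive)
qed

context
  assumes full: "\<And>z. 0 < pmf \<pi> z"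
begin

lemma pmf_reversal: "pmf (reversal P \<pi> z) x = pmf \<pi> x * pmf (P x) z / pmf \<pi> z"
  unfolding reversal_def
proof (rule pmf_embed_pmf)
  have "(\<integral>\<^sup>+x. ennreal (pmf \<pi> x * pmf (P x) z / pmf \<pi> z) \<partial>count_space UNIV)
      = (\<integral>\<^sup>+x. ennreal (pmf \<pi> x) * (ennreal (pmf (P x) z) / ennreal (pmf \<pi> z)) \<partial>count_space UNIV)"
    using full by (intro nn_integral_cong) (simp add: divide_ennreal ennreal_mult[symmetric])
  also have "\<dots> = (\<integral>\<^sup>+x. ennreal (pmf (P x) z) / ennreal (pmf \<pi> z) \<partial>\<pi>)"
    by (simp add: nn_integral_measure_pmf)
  also have "\<dots> = ennreal (pmf (bind_pmf \<pi> P) z) / ennreal (pmf \<pi> z)"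
    by (simp add: nn_integral_divide ennreal_pmf_bind)
  also have "\<dots> = 1" using full[of z] by (simp add: bind_stationary divide_ennreal)
  finally show "(\<integral>\<^sup>+x. ennreal (pmf \<pi> x * pmf (P x) z / pmf \<pi> z) \<partial>count_space UNIV) = 1" .
qed simp

lemma edge_pmf_reversal: "edge_pmf (reversal P \<pi>) \<pi> = map_pmf prod.swap J"
proof (rule pmf_eqI)
  fix e :: "'v \<times> 'v"
  obtain x y where e: "e = (x, y)" by (cases e)
  have "pmf (map_pmf prod.swap J) (x, y) = pmf J (y, x)"
    using pmf_map_inj'[of prod.swap J "(y, x)"] by simp
  moreover have "pmf \<pi> x \<noteq> 0" using full[of x] by simp
  ultimately show "pmf (edge_pmf (reversal P \<pi>) \<pi>) e = pmf (map_pmf prod.swap J) e"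
    by (simp add: e pmf_edge_pmf pmf_reversal)
qed

lemma bind_reversal: "bind_pmf \<pi> (reversal P \<pi>) = \<pi>"
  using map_snd_edge_pmf[of "reversal P \<pi>" \<pi>]
  by (simp add: edge_pmf_reversal pmf.map_comp o_def map_fst_edge_pmf)

lemma profile_reversal: "conductance_profile (reversal P \<pi>) \<pi> = conductance_profile P \<pi>"
proof -
  have "flow (reversal P \<pi>) \<pi> S (- S) = flow P \<pi> S (- S)" for S
  proof -
    have "prod.swap -` (S \<times> - S) = (- S) \<times> S" by auto
    then show ?thesis
      by (simp add: flow_eq_prob_edge_pmf edge_pmf_reversal prob_edge_compl_swap)
  qed
  then show ?thesis by (simp add: conductance_profile_def[abs_def] conductance_def[abs_def])
qed

lemma transition_op_adjoint:
  assumes "bounded_fun f" "bounded_fun g"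
  shows "measure_pmf.expectation \<pi> (\<lambda>z. f z * T g z)
    = measure_pmf.expectation \<pi> (\<lambda>z. transition_op (reversal P \<pi>) f z * g z)"
proof -
  have b: "bounded_fun (\<lambda>e. f (fst e) * g (snd e))" "bounded_fun (\<lambda>e. f (snd e) * g (fst e))"
    by (intro bounded_fun_mult bounded_fun_comp[OF assms(1)] bounded_fun_comp[OF assms(2)])+
  have "measure_pmf.expectation \<pi> (\<lambda>z. f z * T g z) = measure_pmf.expectation J (\<lambda>e. f (fst e) * g (snd e))"
    using expectation_edge_pmf[OF b(1), of P \<pi>] by (simp add: transition_op_def)
  also have "\<dots> = measure_pmf.expectation (edge_pmf (reversal P \<pi>) \<pi>) (\<lambda>e. f (snd e) * g (fst e))"
    by (simp add: edge_pmf_reversal)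
  also have "\<dots> = measure_pmf.expectation \<pi> (\<lambda>z. transition_op (reversal P \<pi>) f z * g z)"
    using expectation_edge_pmf[OF b(2), of "reversal P \<pi>" \<pi>] by (simp add: transition_op_def)
  finally show ?thesis .
qed

lemma transition_op_adjoint_funpow:
  assumes "bounded_fun f" "bounded_fun g"
  shows "measure_pmf.expectation \<pi> (\<lambda>z. f z * (T ^^ m) g z)
    = measure_pmf.expectation \<pi> (\<lambda>z. (transition_op (reversal P \<pi>) ^^ m) f z * g z)"
  using assms(1)
proof (induction m arbitrary: f)
  case (Suc m)
  have "bounded_fun ((T ^^ m) g)" by (induction m) (auto simp: assms(2))
  from transition_op_adjoint[OF Suc.prems this] Suc.IH[OF transition_op_bounded[OF Suc.prems, of "reversal P \<pi>"]]
  show ?case by (simp add: funpow_swap1)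
qed simp

lemma reversed_lazy_chain:
  assumes "\<And>x. 1/2 \<le> pmf (P x) x"
  shows "lazy_chain (reversal P \<pi>) \<pi>"
proof
  show "bind_pmf \<pi> (reversal P \<pi>) = \<pi>" by (rule bind_reversal)
  show "1/2 \<le> pmf (reversal P \<pi> x) x" for x
    using assms[of x] full[of x] by (simp add: pmf_reversal)
qed

end

end

section \<open>From variances to the uniform distance\<close>

lemma abs_expectation_mult_le:
  assumes f: "bounded_fun f" and g: "bounded_fun g"
    and Ef: "measure_pmf.expectation \<pi> f = 1" and Eg: "measure_pmf.expectation \<pi> g = 1"
  shows "\<bar>measure_pmf.expectation \<pi> (\<lambda>z. f z * g z) - 1\<bar> \<le> (chi_square \<pi> f + chi_square \<pi> g) / 2"
proof -
  note int = integrable_bounded_fun[OF f, of \<pi>] integrable_bounded_fun[OF g, of \<pi>]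
    integrable_bounded_fun[OF bounded_fun_mult[OF f g], of \<pi>]
  have b: "bounded_fun (\<lambda>z. f z - 1)" "bounded_fun (\<lambda>z. g z - 1)" using f g by auto
  note bb = integrable_bounded_fun[OF bounded_fun_mult[OF b], of \<pi>]
    integrable_bounded_fun[OF bounded_fun_power2[OF b(1)], of \<pi>]
    integrable_bounded_fun[OF bounded_fun_power2[OF b(2)], of \<pi>]
  have am_gm: "\<bar>a * b\<bar> \<le> (a\<^sup>2 + b\<^sup>2) / 2" for a b :: real
    using sum_squares_bound[of a b] sum_squares_bound[of a "- b"] by (auto simp: abs_if)
  have "measure_pmf.expectation \<pi> (\<lambda>z. f z * g z) - 1
      = measure_pmf.expectation \<pi> (\<lambda>z. f z * g z - f z - g z + 1)"
    using int by (simp add: Ef Eg)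
  also have "\<dots> = measure_pmf.expectation \<pi> (\<lambda>z. (f z - 1) * (g z - 1))"
    by (intro Bochner_Integration.integral_cong) (auto simp: algebra_simps)
  finally have "\<bar>measure_pmf.expectation \<pi> (\<lambda>z. f z * g z) - 1\<bar>
      \<le> measure_pmf.expectation \<pi> (\<lambda>z. \<bar>(f z - 1) * (g z - 1)\<bar>)"
    by (simp add: integral_abs_bound)
  also have "\<dots> \<le> measure_pmf.expectation \<pi> (\<lambda>z. ((f z - 1)\<^sup>2 + (g z - 1)\<^sup>2) / 2)"
    using bb by (intro integral_mono am_gm) auto
  also have "\<dots> = (chi_square \<pi> f + chi_square \<pi> g) / 2"
    using bb by (simp add: chi_square_def)
  finally show ?thesis .
qed

text \<open>Move \<open>m\<close> of the \<open>m + k\<close> applications of \<open>T\<close> to the other factor of the inner product with the point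
density at \<open>x\<close>.\<close>

lemma (in stationary_chain) rel_deviation_le:
  assumes full: "\<And>z. 0 < pmf \<pi> z"
  shows "rel_deviation P \<pi> (m + k) x y
    \<le> (chi_square \<pi> ((transition_op (reversal P \<pi>) ^^ m) (point_density \<pi> x))
        + chi_square \<pi> ((T ^^ k) (point_density \<pi> y))) / 2"
proof -
  interpret R: stationary_chain "reversal P \<pi>" \<pi>
    by standard (rule bind_reversal[OF full])
  note f = R.iterated_density[OF full, of m x] and g = iterated_density[OF full, of k y]
  have "pmf (nstep P (m + k) x) y / pmf \<pi> y = (T ^^ m) ((T ^^ k) (point_density \<pi> y)) x"
    by (simp add: iterated_point_density[symmetric] funpow_add)
  also have "\<dots> = measure_pmf.expectation \<pi> (\<lambda>z. point_density \<pi> x z * (T ^^ m) ((T ^^ k) (point_density \<pi> y)) z)"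
    by (rule expectation_point_density_mult[OF full, symmetric])
  also have "\<dots> = measure_pmf.expectation \<pi>
      (\<lambda>z. (transition_op (reversal P \<pi>) ^^ m) (point_density \<pi> x) z * (T ^^ k) (point_density \<pi> y) z)"
    by (rule transition_op_adjoint_funpow[OF full bounded_fun_point_density g(1)])
  finally have "(pmf (nstep P (m + k) x) y - pmf \<pi> y) / pmf \<pi> y = measure_pmf.expectation \<pi>
      (\<lambda>z. (transition_op (reversal P \<pi>) ^^ m) (point_density \<pi> x) z * (T ^^ k) (point_density \<pi> y) z) - 1"
    using full[of y] by (simp add: diff_divide_distrib)
  then show ?thesis
    unfolding rel_deviation_def using abs_expectation_mult_le[OF f(1) g(1) f(3) g(3)] by simp
qed

text \<open>For \<open>n \<ge> 2\<close>, both halves \<open>m\<close> and \<open>k\<close> of \<open>n\<close> are positive and satisfy \<open>n \<le> 2 (m + 1)\<close>, \<open>n \<le> 2 (k + 1)\<close>; this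
is where the additional gain of the first step absorbs the rounding. For \<open>n = 1\<close> the step is given to the
point of smaller mass.\<close>

lemma (in lazy_chain) rel_deviation_small:
  assumes full: "\<And>z. 0 < pmf \<pi> z" and \<epsilon>: "0 < \<epsilon>"
    and n: "profile_integral P \<pi> (4 * min (pmf \<pi> x) (pmf \<pi> y)) (4 / \<epsilon>) < of_nat n"
  shows "rel_deviation P \<pi> n x y \<le> \<epsilon>"
proof -
  interpret R: lazy_chain "reversal P \<pi>" \<pi>
    using reversed_lazy_chain[OF full lazy] .
  define a where "a = min (pmf \<pi> x) (pmf \<pi> y)"
  have a: "0 < a" "a \<le> pmf \<pi> x" "a \<le> pmf \<pi> y" using full by (auto simp: a_def)
  have I_rev: "profile_integral (reversal P \<pi>) \<pi> = profile_integral P \<pi>"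
    by (simp add: profile_integral_def[abs_def] profile_reversal[OF full])
  let ?v = "\<lambda>k. chi_square \<pi> ((T ^^ k) (point_density \<pi> y))"
  let ?w = "\<lambda>m. chi_square \<pi> ((transition_op (reversal P \<pi>) ^^ m) (point_density \<pi> x))"
  have "n \<noteq> 0" using n by (intro notI) simp
  then consider "n = 1" | "2 \<le> n" by linarith
  then show ?thesis
  proof cases
    case 2
    define m where "m = n div 2"
    define k where "k = n - m"
    have mk: "0 < m" "0 < k" "n = m + k" "real n \<le> 2 * (real m + 1)" "real n \<le> 2 * (real k + 1)"
      using 2 by (auto simp: m_def k_def)
    have less: "profile_integral P \<pi> (4 * a) (4 / \<epsilon>) < ennreal (2 * (real j + 1))" if "real n \<le> 2 * (real j + 1)" for j
    proof -
      have "of_nat n \<le> ennreal (2 * (real j + 1))"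
        unfolding ennreal_of_nat_eq_real_of_nat using that by (rule ennreal_leI)
      with n show ?thesis unfolding a_def by (rule less_le_trans)
    qed
    have "?v k \<le> \<epsilon>" by (rule chi_square_small[OF full \<epsilon> a(1,3) less[OF mk(5)] mk(2)])
    moreover have "?w m \<le> \<epsilon>"
      using less[OF mk(4)] by (intro R.chi_square_small[OF full \<epsilon> a(1,2) _ mk(1)]) (simp only: I_rev)
    ultimately show ?thesis using rel_deviation_le[OF full, of m k x y] mk(3) by simp
  next
    case 1
    have I: "profile_integral P \<pi> (4 * a) (4 / \<epsilon>) \<le> 1" using n 1 by (simp add: a_def)
    have v: "?v j \<le> 1 / pmf \<pi> y - 1" and w: "?w j \<le> 1 / pmf \<pi> x - 1" for j
      by (rule chi_square_iterate_bound[OF full], rule R.chi_square_iterate_bound[OF full])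
    show ?thesis
    proof (cases "a = 1")
      case True
      then have "pmf \<pi> x = 1" "pmf \<pi> y = 1" using a pmf_le_1[of \<pi> x] pmf_le_1[of \<pi> y] by auto
      then have "?v 0 \<le> 0" "?w 1 \<le> 0" using v[of 0] w[of 1] by auto
      then show ?thesis using rel_deviation_le[OF full, of 1 0 x y] 1 \<epsilon> by simp
    next
      case False
      then have "a < 1" using a pmf_le_1[of \<pi> x] by simp
      show ?thesis
      proof (cases "a = pmf \<pi> y")
        case True
        have "(?v 1 + 1 / pmf \<pi> y) / 2 \<le> \<epsilon>"
          using one_step_bound[OF full _ \<epsilon>, of y] \<open>a < 1\<close> I True by simp
        moreover have "1 / pmf \<pi> x \<le> 1 / pmf \<pi> y"
          using True a full by (intro divide_left_mono) auto
        ultimately show ?thesis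
          using rel_deviation_le[OF full, of 0 1 x y] w[of 0] 1 by simp
      next
        case False
        then have ax: "a = pmf \<pi> x" by (auto simp: a_def min_def split: if_splits)
        have "(?w 1 + 1 / pmf \<pi> x) / 2 \<le> \<epsilon>"
          using R.one_step_bound[OF full _ \<epsilon>, of x] \<open>a < 1\<close> I ax by (simp add: I_rev)
        moreover have "1 / pmf \<pi> y \<le> 1 / pmf \<pi> x"
          using ax a full by (intro divide_left_mono) auto
        ultimately show ?thesis
          using rel_deviation_le[OF full, of 1 0 x y] v[of 0] 1 by simp
      qed
    qed
  qed
qed

theorem theorem1:
  fixes P :: "'v::countable \<Rightarrow> 'v pmf" and \<pi> :: "'v pmf" and \<epsilon> :: real
  assumes "irreducible_chain P"
    and "stationary P \<pi>"
    and "\<And>x. pmf (P x) x \<ge> 1/2"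
    and "\<epsilon> > 0"
  shows "ennreal_of_enat (unif_mixing_time P \<pi> \<epsilon>)
           \<le> 1 + profile_integral P \<pi> (4 * (INF x. pmf \<pi> x)) (4 / \<epsilon>)
       \<and> (\<forall>x y. \<forall>n::nat.
             of_nat n \<ge> 1 + profile_integral P \<pi> (4 * min (pmf \<pi> x) (pmf \<pi> y)) (4 / \<epsilon>)
             \<longrightarrow> rel_deviation P \<pi> n x y \<le> \<epsilon>)"
proof -
  interpret lazy_chain P \<pi>
    using assms(2,3) by unfold_locales (auto simp: stationary_iff_bind_pmf)
  have full: "0 < pmf \<pi> z" for z by (rule stationary_pos[OF assms(1)])
  note small = rel_deviation_small[OF full assms(4)]
  show ?thesis
  proof (intro conjI allI impI)
    fix x y and n :: nat
    define I where "I = profile_integral P \<pi> (4 * min (pmf \<pi> x) (pmf \<pi> y)) (4 / \<epsilon>)"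
    assume "of_nat n \<ge> 1 + profile_integral P \<pi> (4 * min (pmf \<pi> x) (pmf \<pi> y)) (4 / \<epsilon>)"
    then have le: "1 + I \<le> of_nat n" by (simp add: I_def)
    then have "I \<noteq> \<top>" by (auto simp: top_unique)
    then have "I < 1 + I" by (simp add: less_le)
    also note le
    finally have "I < of_nat n" .
    then show "rel_deviation P \<pi> n x y \<le> \<epsilon>" unfolding I_def by (rule small)
  next
    define I where "I = profile_integral P \<pi> (4 * (INF x. pmf \<pi> x)) (4 / \<epsilon>)"
    have "ennreal_of_enat (unif_mixing_time P \<pi> \<epsilon>) \<le> 1 + I"
    proof (cases I)
      case (real r)
      \<comment> \<open>The least integer above \<open>I\<close>; rounding \<open>1 + I\<close> up would exceed the bound.\<close>
      define n where "n = nat \<lfloor>r\<rfloor> + 1"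
      have n: "r < real n" "real n \<le> 1 + r" using real(1) by (auto simp: n_def) linarith+
      have "rel_deviation P \<pi> n x y \<le> \<epsilon>" for x y
      proof (rule small)
        have "(INF x. pmf \<pi> x) \<le> pmf \<pi> z" for z
          by (rule cINF_lower) (auto intro!: bdd_belowI[of _ 0])
        then have "profile_integral P \<pi> (4 * min (pmf \<pi> x) (pmf \<pi> y)) (4 / \<epsilon>) \<le> I"
          unfolding I_def by (intro profile_integral_mono) auto
        also have "\<dots> < of_nat n"
          using real n by (simp add: ennreal_of_nat_eq_real_of_nat ennreal_less_iff)
        finally show "profile_integral P \<pi> (4 * min (pmf \<pi> x) (pmf \<pi> y)) (4 / \<epsilon>) < of_nat n" .
      qed
      then have "unif_mixing_time P \<pi> \<epsilon> \<le> enat n"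
        unfolding unif_mixing_time_def by (intro INF_lower) auto
      then have "ennreal_of_enat (unif_mixing_time P \<pi> \<epsilon>) \<le> of_nat n"
        using ennreal_of_enat_le_iff[of _ "enat n"] by simp
      also have "\<dots> \<le> ennreal (1 + r)"
        using n by (simp add: ennreal_of_nat_eq_real_of_nat ennreal_leI del: ennreal_plus)
      also have "\<dots> = 1 + I" using real by (simp add: ennreal_plus)
      finally show ?thesis .
    qed simp
    then show "ennreal_of_enat (unif_mixing_time P \<pi> \<epsilon>)
        \<le> 1 + profile_integral P \<pi> (4 * (INF x. pmf \<pi> x)) (4 / \<epsilon>)"
      by (simp add: I_def)
  qed
qed

end
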